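(* Let $G_1$ be a simple connected graph, $v\in V(G_1)$, $k\ge2$, and let $G=G_1\oplus_vS_{k+1}$ be the graph obtained by attaching $k$ new pendant vertices to $v$ (the star $S_{k+1}$ with its central vertex identified with $v$). Let $\mathscr L$ be any set of $l\ge1$ pairs of distinct vertices of the star $S_{k+1}$ that are not edges (i.e. pairs of the new pendant vertices). Then $\mathscr L$ is a Braess set of $G$ provided $$|E(G_1)|>\begin{cases}\frac18\left[\sqrt{33l^2+50l+17}-l-1\right]&\text{if } l<k,\\[2pt] \frac18\left[\sqrt{33k^2-30k+1}-k-1\right]&\text{if } l\ge k.\end{cases}$$
   Context: For connected $H$ with $m\ge1$ edges and degrees $d_i$, Kemeny's constant is $\mathscr{K}(H)=\sum_j\pi_jm_{ij}$ for the simple random walk on $H$ ($\pi_j=d_j/2m$, $m_{ij}$ expected hitting time of $j$ from $i$, $m_{jj}=0$), equivalently $\frac1{4m}\sum_{i,j}d_id_jr_H(i,j)$ with $r_H$ effective resistance. A Braess set of a graph $G$ is a set of non-edges of $G$ such that adding all of them to $G$ strictly increases Kemeny's constant. *)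

theory Defs
  imports "HOL-Probability.Probability"
begin

record 'a ugraph =
  verts :: "'a set"
  edges :: "'a set set"

definition simple_graph :: "'a ugraph \<Rightarrow> bool" where
  "simple_graph G \<longleftrightarrow>
     finite (verts G) \<and> (\<forall>e \<in> edges G. e \<subseteq> verts G \<and> card e = 2)"

definition connected_graph :: "'a ugraph \<Rightarrow> bool" where
  "connected_graph G \<longleftrightarrow> verts G \<noteq> {} \<and>
     (\<forall>u \<in> verts G. \<forall>w \<in> verts G. (u, w) \<in> {(x, y). {x, y} \<in> edges G}\<^sup>*)"

definition non_edges :: "'a ugraph \<Rightarrow> 'a set set" where
  "non_edges G = {e. e \<subseteq> verts G \<and> card e = 2 \<and> e \<notin> edges G}"

definition add_edges :: "'a ugraph \<Rightarrow> 'a set set \<Rightarrow> 'a ugraph" where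
  "add_edges G L = \<lparr>verts = verts G, edges = edges G \<union> L\<rparr>"

definition star_graph :: "'a \<Rightarrow> 'a set \<Rightarrow> 'a ugraph" where
  "star_graph v P = \<lparr>verts = insert v P, edges = (\<lambda>p. {v, p}) ` P\<rparr>"

text \<open>When two graphs share exactly one vertex \<open>v\<close>, their union is the graph
  obtained by identifying the two copies of \<open>v\<close>.\<close>

definition graph_union :: "'a ugraph \<Rightarrow> 'a ugraph \<Rightarrow> 'a ugraph" where
  "graph_union G H = \<lparr>verts = verts G \<union> verts H, edges = edges G \<union> edges H\<rparr>"

definition nbrs :: "'a ugraph \<Rightarrow> 'a \<Rightarrow> 'a set" where
  "nbrs G i = {j \<in> verts G. {i, j} \<in> edges G}"

definition deg :: "'a ugraph \<Rightarrow> 'a \<Rightarrow> nat" where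
  "deg G i = card (nbrs G i)"

text \<open>Law of the trajectory \<open>[X\<^sub>0, \<dots>, X\<^sub>n]\<close> of the simple random walk started at \<open>X\<^sub>0 = i\<close>.
  Every vertex reached needs a neighbour, which holds in connected graphs with an edge.\<close>

primrec random_walk :: "'a ugraph \<Rightarrow> nat \<Rightarrow> 'a \<Rightarrow> 'a list pmf" where
  "random_walk G 0 i = return_pmf [i]"
| "random_walk G (Suc n) i =
     bind_pmf (pmf_of_set (nbrs G i)) (\<lambda>k. map_pmf ((#) i) (random_walk G n k))"

text \<open>\<open>P(T\<^sub>j = n)\<close> for \<open>T\<^sub>j = min {n \<ge> 0. X\<^sub>n = j}\<close> and the walk started at \<open>i\<close>.\<close>

definition hitting_prob :: "'a ugraph \<Rightarrow> 'a \<Rightarrow> 'a \<Rightarrow> nat \<Rightarrow> real" where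
  "hitting_prob G i j n =
     measure_pmf.prob (random_walk G n i) {xs. last xs = j \<and> j \<notin> set (butlast xs)}"

text \<open>The expectation of \<open>T\<^sub>j\<close>. On a finite connected graph, \<open>T\<^sub>j\<close> is almost surely
  finite and the series converges; no other case is intended. As \<open>T\<^sub>j\<close> counts
  time \<open>0\<close>, the value for \<open>i = j\<close> is \<open>0\<close>.\<close>

definition hitting_time :: "'a ugraph \<Rightarrow> 'a \<Rightarrow> 'a \<Rightarrow> real" where
  "hitting_time G i j = (\<Sum>n. real n * hitting_prob G i j n)"

definition stationary :: "'a ugraph \<Rightarrow> 'a \<Rightarrow> real" where
  "stationary G j = real (deg G j) / (2 * real (card (edges G)))"

text \<open>The common value, over all starting vertices \<open>i\<close>, of the stationary average of the
  hitting times from \<open>i\<close>.\<close>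

definition kemeny :: "'a ugraph \<Rightarrow> real" where
  "kemeny G =
     (THE K. \<forall>i \<in> verts G. K = (\<Sum>j \<in> verts G. stationary G j * hitting_time G i j))"

definition braess_set :: "'a ugraph \<Rightarrow> 'a set set \<Rightarrow> bool" where
  "braess_set G L \<longleftrightarrow> L \<subseteq> non_edges G \<and> kemeny G < kemeny (add_edges G L)"

end

theory Submission
  imports Defs
begin

text \<open>
  Let \<open>g\<close> be the inverse of the Laplacian grounded at \<open>v\<close>, extended by \<open>0\<close>, let \<open>d\<close> be the degrees and
  \<open>W\<close> their sum. The hitting times are \<open>W (g j j - g i j) + (\<Sum>k. d k * (g i k - g j k))\<close>, so Kemeny's
  constant is \<open>T - A / W\<close> with \<open>T = \<Sum>i. d i * g i i\<close> and \<open>A = \<Sum>i j. d i * d j * g i j\<close>. At the cut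
  vertex \<open>v\<close> the matrix \<open>g\<close> is block diagonal, hence \<open>T\<close> and \<open>A\<close> are additive over \<open>G1\<close> and the star.
  The contribution of \<open>G1\<close>, with \<open>m\<close> edges, satisfies \<open>A \<ge> m\<close>. It remains to show
  \<open>A < 2 (m + k + l) (T - k) + k + l\<close> for the star with the new edges. The difference of the two sides
  is superadditive over the components of the new edges, so that one may treat a single component,
  for which \<open>l \<ge> k - 1\<close>.

  There \<open>T - k \<ge> 4 l\<^sup>2 / (k (2 l + k - 1))\<close>, by inserting combinations of two point masses into the
  variational characterisation of \<open>g i i\<close>. The bound on \<open>A\<close> comes from
  \<open>T - A / W \<ge> n - 2 + (tr M\<^sup>2 - 1) / 2\<close>, valid for every graph with \<open>n\<close> vertices and transition
  matrix \<open>M\<close> (whose eigenvalues satisfy \<open>1 / (1 - \<lambda>) \<ge> 1 + \<lambda> + \<lambda>\<^sup>2 / 2\<close>), because \<open>v\<close> is adjacent to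
  all other vertices and so \<open>tr M\<^sup>2 \<ge> 1 + k / (k + 2 l)\<close>.
\<close>

section \<open>Hitting times\<close>

lemma random_walk_nonempty: "xs \<in> set_pmf (random_walk G n i) \<Longrightarrow> xs \<noteq> []"
  by (cases n) auto

lemma hitting_prob_0: "hitting_prob G i j 0 = of_bool (i = j)"
  by (simp add: hitting_prob_def measure_return_pmf indicator_def)

lemma decseq_summable_imp_mult_tendsto_0:
  fixes u :: "nat \<Rightarrow> real"
  assumes "decseq u" "summable u" and nonneg: "\<And>n. u n \<ge> 0"
  shows "(\<lambda>n. real n * u n) \<longlonglongrightarrow> 0"
proof (rule LIMSEQ_I)
  fix \<epsilon> :: real assume "\<epsilon> > 0"
  obtain M where block: "\<And>n. norm (sum u {M..<n}) < \<epsilon> / 2"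
    using summable_Cauchy[of u] assms(2) \<open>\<epsilon> > 0\<close> by (meson half_gt_zero order_refl)
  have "(\<lambda>n. real M * u n) \<longlonglongrightarrow> 0"
    using tendsto_mult[OF tendsto_const summable_LIMSEQ_zero[OF assms(2)], of "real M"] by simp
  then obtain N where start: "\<And>n. n \<ge> N \<Longrightarrow> norm (real M * u n - 0) < \<epsilon> / 2"
    using \<open>\<epsilon> > 0\<close> LIMSEQ_D by (meson half_gt_zero)
  show "\<exists>N. \<forall>n\<ge>N. norm (real n * u n - 0) < \<epsilon>"
  proof (intro exI allI impI)
    fix n assume n: "n \<ge> max M N"
    have "real (n - M) * u n = (\<Sum>i=M..<n. u n)" by simp
    also have "\<dots> \<le> sum u {M..<n}"
      using assms(1) by (intro sum_mono) (simp add: decseq_def)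
    also have "\<dots> < \<epsilon> / 2" using block[of n] by simp
    finally have "real n * u n < \<epsilon> / 2 + real M * u n"
      using n by (simp add: of_nat_diff algebra_simps)
    also have "\<dots> < \<epsilon>" using start[of n] n nonneg[of n] by simp
    finally show "norm (real n * u n - 0) < \<epsilon>" using nonneg[of n] by simp
  qed
qed

lemma sums_mult_difference:
  fixes u p :: "nat \<Rightarrow> real"
  assumes "u sums s" "\<And>n. u n \<ge> 0" "decseq u" and p: "\<And>n. p (Suc n) = u n - u (Suc n)"
  shows "(\<lambda>n. real n * p n) sums s"
proof -
  have by_parts: "(\<Sum>n<Suc N. real n * p n) = (\<Sum>n<N. u n) - real N * u N" for N
    by (induction N) (simp_all add: p algebra_simps)
  have "(\<lambda>N. (\<Sum>n<N. u n) - real N * u N) \<longlonglongrightarrow> s - 0"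
    using assms(1-3) sums_summable[OF assms(1)] unfolding sums_def
    by (intro tendsto_diff decseq_summable_imp_mult_tendsto_0) auto
  then have "(\<lambda>N. \<Sum>n<Suc N. real n * p n) \<longlonglongrightarrow> s"
    unfolding by_parts by simp
  then show ?thesis
    unfolding sums_def by (rule LIMSEQ_imp_Suc)
qed

locale simple_random_walk =
  fixes G :: "'a ugraph"
  assumes finite_verts: "finite (verts G)"
    and nbrs_nonempty: "i \<in> verts G \<Longrightarrow> nbrs G i \<noteq> {}"
begin

definition avg :: "('a \<Rightarrow> real) \<Rightarrow> 'a \<Rightarrow> real" where
  "avg f i = (\<Sum>k\<in>nbrs G i. f k) / real (deg G i)"

definition survival :: "'a \<Rightarrow> nat \<Rightarrow> 'a \<Rightarrow> real" where
  "survival j n i = 1 - (\<Sum>m\<le>n. hitting_prob G i j m)"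

lemma nbrs_subset: "nbrs G i \<subseteq> verts G"
  by (auto simp: nbrs_def)

lemma finite_nbrs: "finite (nbrs G i)"
  using finite_subset[OF nbrs_subset finite_verts] .

lemma deg_pos: "i \<in> verts G \<Longrightarrow> deg G i > 0"
  using nbrs_nonempty finite_nbrs by (simp add: deg_def card_gt_0_iff)

lemma avg_mono: "(\<And>k. k \<in> verts G \<Longrightarrow> f k \<le> f' k) \<Longrightarrow> avg f i \<le> avg f' i"
  unfolding avg_def using nbrs_subset by (intro divide_right_mono sum_mono) auto

lemma avg_const: "i \<in> verts G \<Longrightarrow> avg (\<lambda>_. c) i = c"
  using deg_pos[of i] by (simp add: avg_def deg_def)

lemma avg_diff: "avg (\<lambda>k. f k - f' k) i = avg f i - avg f' i"
  by (simp add: avg_def sum_subtractf diff_divide_distrib)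

lemma avg_cmult: "avg (\<lambda>k. c * f k) i = c * avg f i"
  by (simp add: avg_def sum_distrib_left)

lemma avg_sum: "avg (\<lambda>k. \<Sum>m\<in>S. f m k) i = (\<Sum>m\<in>S. avg (f m) i)"
  unfolding avg_def sum_divide_distrib by (rule sum.swap)

lemma abs_avg_le: "\<bar>avg f i\<bar> \<le> avg (\<lambda>k. \<bar>f k\<bar>) i"
  by (simp add: avg_def divide_right_mono)

lemma hitting_prob_Suc:
  assumes "i \<in> verts G"
  shows "hitting_prob G i j (Suc n) = (if i = j then 0 else avg (\<lambda>k. hitting_prob G k j n) i)"
proof -
  let ?H = "{xs. last xs = j \<and> j \<notin> set (butlast xs)}"
  have prepend: "measure_pmf.prob (map_pmf ((#) i) (random_walk G n k)) ?H =
      (if i = j then 0 else hitting_prob G k j n)" for k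
  proof -
    have "measure_pmf.prob (map_pmf ((#) i) (random_walk G n k)) ?H =
        measure_pmf.prob (random_walk G n k) ((#) i -` ?H)"
      by simp
    also have "\<dots> = measure_pmf.prob (random_walk G n k) (if i = j then {} else ?H)"
      by (rule measure_pmf.finite_measure_eq_AE)
         (auto simp: AE_measure_pmf_iff dest: random_walk_nonempty)
    finally show ?thesis
      by (simp add: hitting_prob_def)
  qed
  have "hitting_prob G i j (Suc n) =
      measure_pmf.expectation (pmf_of_set (nbrs G i))
        (\<lambda>k. measure_pmf.prob (map_pmf ((#) i) (random_walk G n k)) ?H)"
    unfolding hitting_prob_def random_walk.simps measure_pmf_bind
    by (rule measure_pmf.measure_bind[where N = "count_space UNIV"])
       (auto simp: measure_pmf_in_subprob_algebra)
  then show ?thesis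
    unfolding prepend using finite_nbrs nbrs_nonempty[OF assms]
    by (simp add: integral_pmf_of_set avg_def deg_def)
qed

lemma survival_0: "survival j 0 i = of_bool (i \<noteq> j)"
  by (simp add: survival_def hitting_prob_0)

lemma survival_Suc:
  assumes "i \<in> verts G"
  shows "survival j (Suc n) i = (if i = j then 0 else avg (survival j n) i)"
proof -
  have "survival j (Suc n) i =
      1 - hitting_prob G i j 0 - (\<Sum>m\<le>n. hitting_prob G i j (Suc m))"
    unfolding survival_def by (subst sum.atMost_Suc_shift) simp
  also have "\<dots> = (if i = j then 0 else avg (survival j n) i)"
    using assms unfolding survival_def
    by (simp add: hitting_prob_Suc hitting_prob_0 avg_diff avg_const avg_sum)
  finally show ?thesis .
qed

lemma survival_target: "j \<in> verts G \<Longrightarrow> survival j n j = 0"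
  by (cases n) (simp_all add: survival_0 survival_Suc)

lemma survival_nonneg: "i \<in> verts G \<Longrightarrow> survival j n i \<ge> 0"
proof (induction n arbitrary: i)
  case (Suc n)
  then show ?case
    using avg_mono[of "\<lambda>_. 0" "survival j n" i] by (simp add: survival_Suc avg_const)
qed (simp add: survival_0)

lemma survival_decseq: "decseq (\<lambda>n. survival j n i)"
  by (intro decseq_SucI) (simp add: survival_def hitting_prob_def)

lemma hitting_time_eq_survival_sum:
  assumes "i \<in> verts G" "(\<lambda>n. survival j n i) sums s"
  shows "hitting_time G i j = s"
proof -
  have "(\<lambda>n. real n * hitting_prob G i j n) sums s"
    using assms(2) survival_nonneg[OF assms(1)] survival_decseq
    by (rule sums_mult_difference) (simp add: survival_def)
  then show ?thesis
    by (simp add: hitting_time_def sums_iff)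
qed

context
  fixes h :: "'a \<Rightarrow> real" and j :: 'a
  assumes j: "j \<in> verts G" "h j = 0"
    and poisson: "\<And>i. i \<in> verts G \<Longrightarrow> i \<noteq> j \<Longrightarrow> h i = 1 + avg h i"
begin

text \<open>The remainder is the expectation of \<open>h\<close> at time \<open>n\<close> on the event that \<open>j\<close> has not been hit.\<close>

lemma poisson_remainder_Suc:
  assumes "i \<in> verts G"
  shows "h i - (\<Sum>m<Suc n. survival j m i) =
    (if i = j then 0 else avg (\<lambda>k. h k - (\<Sum>m<n. survival j m k)) i)"
proof (cases "i = j")
  case False
  have "h i - (\<Sum>m<Suc n. survival j m i) = h i - 1 - (\<Sum>m<n. survival j (Suc m) i)"
    using False by (simp add: sum.lessThan_Suc_shift survival_0 del: sum.lessThan_Suc)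
  also have "\<dots> = avg h i - (\<Sum>m<n. avg (survival j m) i)"
    using False assms poisson[OF assms False] by (simp add: survival_Suc)
  finally show ?thesis
    using False by (simp add: avg_diff avg_sum)
qed (use j survival_target in simp)

lemma abs_poisson_remainder_le:
  assumes "\<And>i. i \<in> verts G \<Longrightarrow> \<bar>h i\<bar> \<le> C" "i \<in> verts G"
  shows "\<bar>h i - (\<Sum>m<n. survival j m i)\<bar> \<le> C * survival j n i"
  using assms(2)
proof (induction n arbitrary: i)
  case 0
  then show ?case using assms(1)[of i] j by (simp add: survival_0)
next
  case (Suc n)
  show ?case
  proof (cases "i = j")
    case False
    let ?r = "\<lambda>k. h k - (\<Sum>m<n. survival j m k)"
    have "\<bar>avg ?r i\<bar> \<le> avg (\<lambda>k. \<bar>?r k\<bar>) i" by (rule abs_avg_le)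
    also have "\<dots> \<le> avg (\<lambda>k. C * survival j n k) i" using Suc.IH by (rule avg_mono)
    also have "\<dots> = C * survival j (Suc n) i"
      using False Suc.prems by (simp add: survival_Suc avg_cmult)
    finally show ?thesis using False poisson_remainder_Suc[OF Suc.prems, of n] by simp
  qed (use poisson_remainder_Suc[OF Suc.prems, of n] survival_target[OF j(1)] in simp)
qed

lemma hitting_time_eqI:
  assumes i: "i \<in> verts G"
  shows "hitting_time G i j = h i"
proof (rule hitting_time_eq_survival_sum[OF i])
  define C where "C = Max ((\<lambda>k. \<bar>h k\<bar>) ` verts G)"
  have C: "\<bar>h k\<bar> \<le> C" if "k \<in> verts G" for k
    using finite_verts that by (simp add: C_def)
  note remainder = abs_poisson_remainder_le[OF C i]
  have "C \<ge> 0" using C[OF i] by linarith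
  have "survival j n i \<le> 1" for n
    by (simp add: survival_def hitting_prob_def sum_nonneg)
  then have "C * survival j n i \<le> C" for n
    using \<open>C \<ge> 0\<close> by (simp add: mult_left_le)
  have "summable (\<lambda>n. survival j n i)"
  proof (rule summableI_nonneg_bounded)
    show "(\<Sum>m<n. survival j m i) \<le> h i + C" for n
      using remainder[of n] \<open>C * survival j n i \<le> C\<close> by linarith
  qed (rule survival_nonneg[OF i])
  then have "(\<lambda>n. C * survival j n i) \<longlonglongrightarrow> 0"
    using tendsto_mult_left[OF summable_LIMSEQ_zero, of _ C] by simp
  then have "(\<lambda>n. h i - (\<Sum>m<n. survival j m i)) \<longlonglongrightarrow> 0"
    by (rule Lim_null_comparison[rotated]) (simp add: remainder)
  from tendsto_diff[OF tendsto_const this, of "h i"]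
  show "(\<lambda>n. survival j n i) sums h i"
    by (simp add: sums_def)
qed

end

end

section \<open>Linear systems over finite index sets\<close>

lemma homogeneous_system_nontrivial_solution:
  fixes M :: "'e \<Rightarrow> 'a \<Rightarrow> 'b :: field"
  assumes "finite E" "finite S" "card E < card S"
  shows "\<exists>x. (\<exists>j\<in>S. x j \<noteq> 0) \<and> (\<forall>i\<in>E. (\<Sum>j\<in>S. M i j * x j) = 0)"
  using assms
proof (induction E arbitrary: S M rule: finite_induct)
  case empty
  then obtain p where "p \<in> S" by fastforce
  then show ?case by (intro exI[of _ "\<lambda>_. 1"]) auto
next
  case (insert e E)
  show ?case
  proof (cases "\<exists>p\<in>S. M e p \<noteq> 0")
    case False
    with insert.IH[of S M] insert.prems insert.hyps show ?thesis by auto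
  next
    case True
    then obtain p where p: "p \<in> S" "M e p \<noteq> 0" by blast
    define M' where "M' = (\<lambda>i j. M i j - M i p / M e p * M e j)"
    have "finite (S - {p})" "card E < card (S - {p})"
      using insert.prems insert.hyps p by simp_all
    from insert.IH[OF this, of M'] obtain x
      where x: "\<exists>j\<in>S - {p}. x j \<noteq> 0" "\<And>i. i \<in> E \<Longrightarrow> (\<Sum>j\<in>S - {p}. M' i j * x j) = 0"
      by blast
    define y where "y = x(p := - (\<Sum>j\<in>S - {p}. M e j * x j) / M e p)"
    have "(\<Sum>j\<in>S. M i j * y j) = (\<Sum>j\<in>S - {p}. M' i j * x j)" for i
    proof -
      have "(\<Sum>j\<in>S. M i j * y j) = M i p * y p + (\<Sum>j\<in>S - {p}. M i j * x j)"
        using insert.prems p by (simp add: sum.remove y_def)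
      also have "M i p * y p = - (\<Sum>j\<in>S - {p}. M i p / M e p * M e j * x j)"
        by (simp add: y_def sum_divide_distrib sum_distrib_left mult.assoc)
      finally show ?thesis
        by (simp add: M'_def left_diff_distrib sum_subtractf)
    qed
    moreover have "M' e j = 0" for j using p by (simp add: M'_def)
    ultimately have "\<forall>i\<in>insert e E. (\<Sum>j\<in>S. M i j * y j) = 0" using x(2) by simp
    moreover have "\<exists>j\<in>S. y j \<noteq> 0" using x(1) by (auto simp: y_def)
    ultimately show ?thesis by blast
  qed
qed

lemma linear_system_solvable_if_trivial_kernel:
  fixes M :: "'a \<Rightarrow> 'a \<Rightarrow> 'b :: field"
  assumes S: "finite S"
    and kernel: "\<And>x i. (\<And>i. i \<in> S \<Longrightarrow> (\<Sum>j\<in>S. M i j * x j) = 0) \<Longrightarrow> i \<in> S \<Longrightarrow> x i = 0"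
  shows "\<exists>x. \<forall>i\<in>S. (\<Sum>j\<in>S. M i j * x j) = b i"
proof -
  \<comment> \<open>A nontrivial solution of the homogeneous system \<open>M x = t b\<close> in \<open>x\<close> and \<open>t\<close> has \<open>t \<noteq> 0\<close>.\<close>
  define S' where "S' = insert None (Some ` S)"
  define M' where "M' = (\<lambda>i q. case q of None \<Rightarrow> - b i | Some j \<Rightarrow> M i j)"
  have "finite S'" "card S < card S'"
    using S by (simp_all add: S'_def card_image image_iff)
  from homogeneous_system_nontrivial_solution[OF S this, of M'] obtain y
    where y: "\<exists>q\<in>S'. y q \<noteq> 0" "\<And>i. i \<in> S \<Longrightarrow> (\<Sum>q\<in>S'. M' i q * y q) = 0"
    by blast
  have "(\<Sum>q\<in>S'. M' i q * y q) = (\<Sum>j\<in>S. M i j * y (Some j)) - b i * y None" for i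
    using S by (simp add: S'_def M'_def sum.reindex image_iff)
  then have system: "(\<Sum>j\<in>S. M i j * y (Some j)) = b i * y None" if "i \<in> S" for i
    using y(2)[OF that] by simp
  have "y None \<noteq> 0"
  proof
    assume "y None = 0"
    then have "y (Some i) = 0" if "i \<in> S" for i
      using kernel[of "\<lambda>j. y (Some j)"] system that by simp
    with \<open>y None = 0\<close> y(1) show False by (auto simp: S'_def)
  qed
  then have "(\<Sum>j\<in>S. M i j * (y (Some j) / y None)) = b i" if "i \<in> S" for i
    using system[OF that] by (simp flip: sum_divide_distrib)
  then show ?thesis by (intro exI[of _ "\<lambda>j. y (Some j) / y None"]) blast
qed

section \<open>Laplacian and energy of a network\<close>

definition wdeg :: "('a \<Rightarrow> 'a \<Rightarrow> real) \<Rightarrow> 'a set \<Rightarrow> 'a \<Rightarrow> real" where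
  "wdeg a V i = (\<Sum>j\<in>V. a i j)"

definition vol :: "('a \<Rightarrow> 'a \<Rightarrow> real) \<Rightarrow> 'a set \<Rightarrow> real" where
  "vol a V = (\<Sum>i\<in>V. wdeg a V i)"

definition laplacian :: "('a \<Rightarrow> 'a \<Rightarrow> real) \<Rightarrow> 'a set \<Rightarrow> ('a \<Rightarrow> real) \<Rightarrow> 'a \<Rightarrow> real" where
  "laplacian a V x i = wdeg a V i * x i - (\<Sum>j\<in>V. a i j * x j)"

definition energy :: "('a \<Rightarrow> 'a \<Rightarrow> real) \<Rightarrow> 'a set \<Rightarrow> ('a \<Rightarrow> real) \<Rightarrow> ('a \<Rightarrow> real) \<Rightarrow> real" where
  "energy a V x y = (\<Sum>i\<in>V. \<Sum>j\<in>V. a i j * (x i - x j) * (y i - y j)) / 2"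

lemma laplacian_const: "laplacian a V (\<lambda>_. c) i = 0"
  by (simp add: laplacian_def wdeg_def sum_distrib_right)

lemma laplacian_add: "laplacian a V (\<lambda>k. x k + y k) i = laplacian a V x i + laplacian a V y i"
  by (simp add: laplacian_def algebra_simps sum.distrib)

lemma laplacian_diff: "laplacian a V (\<lambda>k. x k - y k) i = laplacian a V x i - laplacian a V y i"
  by (simp add: laplacian_def algebra_simps sum_subtractf)

lemma laplacian_cmult: "laplacian a V (\<lambda>k. c * x k) i = c * laplacian a V x i"
  by (simp add: laplacian_def algebra_simps sum_distrib_left)

lemma laplacian_sum: "laplacian a V (\<lambda>k. \<Sum>n\<in>S. x n k) i = (\<Sum>n\<in>S. laplacian a V (x n) i)"
  unfolding laplacian_def sum_distrib_left sum_subtractf by (subst sum.swap) simp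

lemma laplacian_of_bool:
  assumes "finite V" "p \<in> V"
  shows "laplacian a V (\<lambda>k. of_bool (k = p)) i = wdeg a V i * of_bool (i = p) - a i p"
  using assms by (simp add: laplacian_def)

lemma laplacian_cong:
  assumes "\<And>i j. i \<in> V \<Longrightarrow> j \<in> V \<Longrightarrow> a i j = b i j" "\<And>j. j \<in> V \<Longrightarrow> x j = y j" "i \<in> V"
  shows "laplacian a V x i = laplacian b V y i"
  using assms by (simp add: laplacian_def wdeg_def)

locale network =
  fixes a :: "'a \<Rightarrow> 'a \<Rightarrow> real"
  assumes a_sym: "a i j = a j i" and a_nonneg: "a i j \<ge> 0" and a_irrefl: "a i i = 0"
begin

lemma wdeg_nonneg: "wdeg a V i \<ge> 0"
  by (simp add: wdeg_def sum_nonneg a_nonneg)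

lemma vol_nonneg: "vol a V \<ge> 0"
  by (simp add: vol_def sum_nonneg wdeg_nonneg)

lemma vol_mono:
  assumes "finite V" "U \<subseteq> V"
  shows "vol a U \<le> vol a V"
proof -
  have "vol a U \<le> (\<Sum>i\<in>U. wdeg a V i)"
    unfolding vol_def wdeg_def using assms a_nonneg by (intro sum_mono sum_mono2) auto
  also have "\<dots> \<le> vol a V"
    unfolding vol_def using assms wdeg_nonneg by (intro sum_mono2) auto
  finally show ?thesis .
qed

lemma vol_pos:
  assumes "finite V" "v \<in> V" "\<And>i. i \<in> V \<Longrightarrow> wdeg a V i > 0"
  shows "vol a V > 0"
  unfolding vol_def using assms by (intro sum_pos) auto

lemma wdeg_le_half_vol:
  assumes "finite V" "v \<in> V"
  shows "wdeg a V v \<le> vol a V / 2"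
proof -
  have "wdeg a V v = (\<Sum>i\<in>V - {v}. a i v)"
    unfolding wdeg_def using assms by (simp add: sum.remove a_irrefl a_sym)
  also have "\<dots> \<le> (\<Sum>i\<in>V - {v}. wdeg a V i)"
    unfolding wdeg_def using assms a_nonneg by (intro sum_mono member_le_sum) auto
  also have "\<dots> = vol a V - wdeg a V v"
    unfolding vol_def using assms by (simp add: sum.remove)
  finally show ?thesis by simp
qed

lemma sum_laplacian: "(\<Sum>i\<in>V. y i * laplacian a V x i) = energy a V x y"
proof -
  let ?S = "\<lambda>f. \<Sum>i\<in>V. \<Sum>j\<in>V. a i j * f i j"
  have swap: "?S f = ?S (\<lambda>i j. f j i)" for f
    by (subst sum.swap) (simp add: a_sym)
  have "energy a V x y =
      (?S (\<lambda>i j. x i * y i) - ?S (\<lambda>i j. x i * y j) - ?S (\<lambda>i j. x j * y i)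
        + ?S (\<lambda>i j. x j * y j)) / 2"
    unfolding energy_def by (simp add: algebra_simps sum.distrib sum_subtractf)
  also have "\<dots> = ?S (\<lambda>i j. x i * y i) - ?S (\<lambda>i j. x j * y i)"
    using swap[of "\<lambda>i j. x i * y i"] swap[of "\<lambda>i j. x i * y j"] by simp
  also have "\<dots> = (\<Sum>i\<in>V. y i * laplacian a V x i)"
    unfolding laplacian_def wdeg_def
    by (simp add: algebra_simps sum_distrib_left sum_distrib_right sum_subtractf)
  finally show ?thesis by simp
qed

lemma sum_laplacian_eq_0: "(\<Sum>i\<in>V. laplacian a V x i) = 0"
  using sum_laplacian[of "\<lambda>_. 1" V x] by (simp add: energy_def)

lemma energy_commute: "energy a V x y = energy a V y x"
  by (simp add: energy_def mult.commute mult.left_commute)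

lemma energy_nonneg: "energy a V x x \<ge> 0"
  unfolding energy_def
  by (intro divide_nonneg_nonneg sum_nonneg) (simp_all add: a_nonneg mult.assoc)

lemma energy_eq_0_imp_constant_on_edges:
  assumes "finite V" "energy a V x x = 0" "i \<in> V" "j \<in> V" "a i j > 0"
  shows "x i = x j"
proof -
  have "(\<Sum>i\<in>V. \<Sum>j\<in>V. a i j * (x i - x j) * (x i - x j)) = 0"
    using assms(2) by (simp add: energy_def)
  then have "a i j * (x i - x j) * (x i - x j) = 0"
    using assms(1,3,4) by (simp add: sum_nonneg_eq_0_iff sum_nonneg a_nonneg mult.assoc)
  then show ?thesis using assms(5) by simp
qed

lemma energy_diff_left:
  "energy a V (\<lambda>i. x i - y i) z = energy a V x z - energy a V y z"
  unfolding sum_laplacian[symmetric] by (simp add: laplacian_diff right_diff_distrib sum_subtractf)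

lemma energy_dual: "2 * energy a V x y - energy a V y y \<le> energy a V x x"
proof -
  let ?z = "\<lambda>i. x i - y i"
  have "energy a V ?z ?z = energy a V ?z x - energy a V ?z y"
    using energy_diff_left[of V x y ?z] energy_commute[of V ?z x] energy_commute[of V ?z y] by simp
  also have "\<dots> = energy a V x x - 2 * energy a V x y + energy a V y y"
    using energy_commute[of V y x] by (simp add: energy_diff_left)
  finally show ?thesis
    using energy_nonneg[of V ?z] by simp
qed

lemma energy_le: "energy a V y y \<le> 2 * (\<Sum>i\<in>V. wdeg a V i * (y i)\<^sup>2)"
proof -
  have "(y i - y j) * (y i - y j) \<le> 2 * ((y i)\<^sup>2 + (y j)\<^sup>2)" for i j
    using zero_le_power2[of "y i + y j"] by (simp add: power2_eq_square algebra_simps)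
  then have "2 * energy a V y y \<le> (\<Sum>i\<in>V. \<Sum>j\<in>V. a i j * (2 * ((y i)\<^sup>2 + (y j)\<^sup>2)))"
    unfolding energy_def by (simp add: mult.assoc sum_mono mult_left_mono a_nonneg)
  also have "\<dots> = 2 * ((\<Sum>i\<in>V. \<Sum>j\<in>V. a i j * (y i)\<^sup>2) + (\<Sum>i\<in>V. \<Sum>j\<in>V. a i j * (y j)\<^sup>2))"
    by (simp add: algebra_simps sum.distrib sum_distrib_left)
  also have "(\<Sum>i\<in>V. \<Sum>j\<in>V. a i j * (y j)\<^sup>2) = (\<Sum>i\<in>V. \<Sum>j\<in>V. a i j * (y i)\<^sup>2)"
    by (subst sum.swap) (simp add: a_sym)
  finally show ?thesis by (simp add: wdeg_def sum_distrib_right)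
qed

lemma energy_of_bool_diff:
  fixes \<alpha> \<beta> :: real
  assumes "finite V" "p \<in> V" "q \<in> V" "p \<noteq> q"
  defines "x \<equiv> \<lambda>i. \<alpha> * of_bool (i = p) - \<beta> * of_bool (i = q)"
  shows "energy a V x x = \<alpha>\<^sup>2 * wdeg a V p + 2 * \<alpha> * \<beta> * a p q + \<beta>\<^sup>2 * wdeg a V q"
proof -
  have "energy a V x x = \<alpha> * laplacian a V x p - \<beta> * laplacian a V x q"
    using assms(1-3) unfolding sum_laplacian[symmetric]
    by (simp add: x_def left_diff_distrib sum_subtractf mult.assoc flip: sum_distrib_left)
  moreover have "laplacian a V x i =
      \<alpha> * (wdeg a V i * of_bool (i = p) - a i p) - \<beta> * (wdeg a V i * of_bool (i = q) - a i q)" for i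
    unfolding x_def laplacian_diff laplacian_cmult using assms(1-3)
    by (simp only: laplacian_of_bool)
  ultimately show ?thesis
    using assms(4) a_sym[of q p] by (simp add: a_irrefl power2_eq_square algebra_simps)
qed

end

section \<open>Green functions\<close>

definition potential :: "'a set \<Rightarrow> ('a \<Rightarrow> 'a \<Rightarrow> real) \<Rightarrow> ('a \<Rightarrow> real) \<Rightarrow> 'a \<Rightarrow> real" where
  "potential V g b i = (\<Sum>j\<in>V. g i j * b j)"

definition green_form :: "'a set \<Rightarrow> ('a \<Rightarrow> 'a \<Rightarrow> real) \<Rightarrow> ('a \<Rightarrow> real) \<Rightarrow> ('a \<Rightarrow> real) \<Rightarrow> real" where
  "green_form V g b c = (\<Sum>i\<in>V. b i * potential V g c i)"

definition green_trace :: "('a \<Rightarrow> 'a \<Rightarrow> real) \<Rightarrow> 'a set \<Rightarrow> ('a \<Rightarrow> 'a \<Rightarrow> real) \<Rightarrow> real" where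
  "green_trace a V g = (\<Sum>i\<in>V. wdeg a V i * g i i)"

definition green_mass :: "('a \<Rightarrow> 'a \<Rightarrow> real) \<Rightarrow> 'a set \<Rightarrow> ('a \<Rightarrow> 'a \<Rightarrow> real) \<Rightarrow> real" where
  "green_mass a V g = green_form V g (wdeg a V) (wdeg a V)"

definition return_trace :: "('a \<Rightarrow> 'a \<Rightarrow> real) \<Rightarrow> 'a set \<Rightarrow> real" where
  "return_trace a V = (\<Sum>i\<in>V. \<Sum>j\<in>V. (a i j)\<^sup>2 / (wdeg a V i * wdeg a V j))"

lemma potential_diff_cmult:
  "potential V g (\<lambda>k. b k - t * c k) i = potential V g b i - t * potential V g c i"
  by (simp add: potential_def algebra_simps sum_subtractf sum_distrib_left)

locale green_function = network a for a :: "'a \<Rightarrow> 'a \<Rightarrow> real" +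
  fixes V :: "'a set" and v :: 'a and g :: "'a \<Rightarrow> 'a \<Rightarrow> real"
  assumes finite_V: "finite V" and ground_in: "v \<in> V"
    and green_ground: "j \<in> V \<Longrightarrow> g v j = 0"
    and laplacian_green_off_ground:
      "i \<in> V \<Longrightarrow> i \<noteq> v \<Longrightarrow> j \<in> V \<Longrightarrow> laplacian a V (\<lambda>n. g n j) i = of_bool (i = j)"
begin

lemma laplacian_green:
  assumes "i \<in> V" "j \<in> V"
  shows "laplacian a V (\<lambda>n. g n j) i = of_bool (i = j) - of_bool (i = v)"
proof (cases "i = v")
  case True
  have "laplacian a V (\<lambda>n. g n j) v = - (\<Sum>i\<in>V - {v}. laplacian a V (\<lambda>n. g n j) i)"
    using sum_laplacian_eq_0[of V "\<lambda>n. g n j"]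
    by (simp add: sum.remove[OF finite_V ground_in] eq_neg_iff_add_eq_0)
  also have "\<dots> = - (\<Sum>i\<in>V - {v}. of_bool (i = j))"
    using assms by (simp add: laplacian_green_off_ground)
  also have "\<dots> = of_bool (v = j) - 1"
    using assms finite_V by (cases "j = v") (simp_all add: of_bool_def)
  finally show ?thesis using True by simp
qed (use assms in \<open>simp add: laplacian_green_off_ground\<close>)

lemma green_representation:
  assumes "i \<in> V"
  shows "x i = x v + (\<Sum>k\<in>V. g k i * laplacian a V x k)"
proof -
  have "(\<Sum>k\<in>V. g k i * laplacian a V x k) = (\<Sum>k\<in>V. x k * laplacian a V (\<lambda>n. g n i) k)"
    unfolding sum_laplacian by (rule energy_commute)
  also have "\<dots> = x i - x v"
    using assms finite_V ground_in by (simp add: laplacian_green right_diff_distrib sum_subtractf)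
  finally show ?thesis by simp
qed

lemma green_transpose_eq:
  assumes "green_function a V v g'" "i \<in> V" "j \<in> V"
  shows "g' i j = g j i"
proof -
  interpret other: green_function a V v g' by fact
  show ?thesis
    using assms(2,3) finite_V ground_in green_representation[of i "\<lambda>n. g' n j"]
    by (simp add: other.laplacian_green other.green_ground green_ground right_diff_distrib
        sum_subtractf)
qed

lemma green_sym: "i \<in> V \<Longrightarrow> j \<in> V \<Longrightarrow> g i j = g j i"
  by (rule green_transpose_eq[OF green_function_axioms])

lemma green_unique: "green_function a V v g' \<Longrightarrow> i \<in> V \<Longrightarrow> j \<in> V \<Longrightarrow> g' i j = g i j"
  using green_transpose_eq green_sym by metis

lemma green_ground_right: "i \<in> V \<Longrightarrow> g i v = 0"
  using green_sym[of i v] green_ground ground_in by simp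

lemma potential_ground: "potential V g b v = 0"
  by (simp add: potential_def green_ground)

lemma laplacian_potential:
  assumes "i \<in> V"
  shows "laplacian a V (potential V g b) i = b i - of_bool (i = v) * (\<Sum>k\<in>V. b k)"
proof -
  have "laplacian a V (potential V g b) i = (\<Sum>k\<in>V. b k * laplacian a V (\<lambda>n. g n k) i)"
    unfolding potential_def by (simp add: laplacian_sum laplacian_cmult mult.commute[of "g _ _"])
  then show ?thesis
    using assms finite_V
    by (simp add: laplacian_green right_diff_distrib sum_subtractf mult.commute
        flip: sum_distrib_left)
qed

lemma green_form_commute: "green_form V g b c = green_form V g c b"
proof -
  have "green_form V g b c = (\<Sum>j\<in>V. \<Sum>i\<in>V. b i * (g i j * c j))"
    unfolding green_form_def potential_def sum_distrib_left by (rule sum.swap)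
  also have "\<dots> = green_form V g c b"
    unfolding green_form_def potential_def sum_distrib_left
    by (intro sum.cong refl) (simp add: green_sym)
  finally show ?thesis .
qed

lemma green_form_diff_cmult:
  "green_form V g (\<lambda>k. b k - t * c k) (\<lambda>k. b k - t * c k) =
    green_form V g b b - 2 * t * green_form V g b c + t\<^sup>2 * green_form V g c c"
proof -
  have "green_form V g (\<lambda>k. b k - t * c k) (\<lambda>k. b k - t * c k) = green_form V g b b
      - t * green_form V g b c - t * green_form V g c b + t\<^sup>2 * green_form V g c c"
    unfolding green_form_def potential_diff_cmult
    by (simp add: algebra_simps power2_eq_square sum.distrib sum_subtractf sum_distrib_left)
  then show ?thesis by (simp add: green_form_commute[of c b])
qed

lemma energy_potential:
  "energy a V (potential V g b) y = (\<Sum>i\<in>V. b i * (y i - y v))"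
proof -
  have "energy a V (potential V g b) y =
      (\<Sum>i\<in>V. b i * y i - of_bool (i = v) * (y i * (\<Sum>k\<in>V. b k)))"
    unfolding sum_laplacian[symmetric]
    by (intro sum.cong refl) (simp add: laplacian_potential algebra_simps)
  also have "\<dots> = (\<Sum>i\<in>V. b i * y i) - y v * (\<Sum>k\<in>V. b k)"
    using finite_V ground_in by (simp add: sum_subtractf)
  finally show ?thesis
    by (simp add: right_diff_distrib sum_subtractf mult.commute flip: sum_distrib_right)
qed

lemma green_form_ge_dual:
  "2 * (\<Sum>i\<in>V. b i * (y i - y v)) - energy a V y y \<le> green_form V g b b"
proof -
  have "energy a V (potential V g b) (potential V g b) = green_form V g b b"
    by (simp add: energy_potential potential_ground green_form_def)
  then show ?thesis
    using energy_dual[of V "potential V g b" y] by (simp add: energy_potential)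
qed

lemma green_diag_ge_dual:
  assumes "i \<in> V"
  shows "2 * (y i - y v) - energy a V y y \<le> g i i"
  using green_form_ge_dual[of "\<lambda>k. of_bool (k = i)" y] assms finite_V
  by (simp add: green_form_def potential_def)

lemma green_diag_ge:
  assumes i: "i \<in> V" "i \<noteq> v"
    and det_pos: "wdeg a V i * wdeg a V v - (a i v)\<^sup>2 > 0"
  shows "(wdeg a V i + wdeg a V v - 2 * a i v) / (wdeg a V i * wdeg a V v - (a i v)\<^sup>2) \<le> g i i"
proof -
  define D where "D = wdeg a V i * wdeg a V v - (a i v)\<^sup>2"
  \<comment> \<open>These coefficients maximise the dual functional over combinations of two point masses.\<close>
  define \<alpha> where "\<alpha> = (wdeg a V v - a i v) / D"
  define \<beta> where "\<beta> = (wdeg a V i - a i v) / D"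
  have "D > 0" using det_pos by (simp add: D_def)
  have stationary: "\<alpha> * wdeg a V i + \<beta> * a i v = 1" "\<alpha> * a i v + \<beta> * wdeg a V v = 1"
    using \<open>D > 0\<close> unfolding \<alpha>_def \<beta>_def
    by (simp_all add: add_divide_distrib[symmetric] divide_eq_1_iff)
      (simp_all add: D_def power2_eq_square algebra_simps)
  have "\<alpha>\<^sup>2 * wdeg a V i + 2 * \<alpha> * \<beta> * a i v + \<beta>\<^sup>2 * wdeg a V v =
      \<alpha> * (\<alpha> * wdeg a V i + \<beta> * a i v) + \<beta> * (\<alpha> * a i v + \<beta> * wdeg a V v)"
    by (simp add: power2_eq_square algebra_simps)
  also have "\<dots> = \<alpha> + \<beta>" by (simp add: stationary)
  finally have "\<alpha> + \<beta> \<le> g i i"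
    using green_diag_ge_dual[OF i(1), of "\<lambda>k. \<alpha> * of_bool (k = i) - \<beta> * of_bool (k = v)"] i(2)
    by (simp add: energy_of_bool_diff[OF finite_V i(1) ground_in i(2)])
  moreover have "\<alpha> + \<beta> = (wdeg a V i + wdeg a V v - 2 * a i v) / D"
    by (simp add: \<alpha>_def \<beta>_def add_divide_distrib[symmetric] algebra_simps)
  ultimately show ?thesis by (simp add: D_def)
qed

lemma wdeg_mult_green_diag_ge_1:
  assumes i: "i \<in> V" "i \<noteq> v" and pos: "wdeg a V i > 0"
  shows "1 \<le> wdeg a V i * g i i"
proof -
  define \<alpha> where "\<alpha> = 1 / wdeg a V i"
  have "2 * \<alpha> - \<alpha>\<^sup>2 * wdeg a V i \<le> g i i"
    using green_diag_ge_dual[OF i(1), of "\<lambda>k. \<alpha> * of_bool (k = i) - 0 * of_bool (k = v)"] i(2)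
    unfolding energy_of_bool_diff[OF finite_V i(1) ground_in i(2)] by simp
  moreover have "2 * \<alpha> - \<alpha>\<^sup>2 * wdeg a V i = \<alpha>"
    using pos by (simp add: \<alpha>_def power2_eq_square)
  ultimately show ?thesis
    using pos by (simp add: \<alpha>_def pos_divide_le_eq mult.commute)
qed

lemma green_trace_ge:
  assumes pos: "\<And>i. i \<in> V \<Longrightarrow> wdeg a V i > 0"
  shows "real (card V) - 1 \<le> green_trace a V g"
proof -
  have "real (card V) - 1 = (\<Sum>i\<in>V - {v}. 1)"
    by (simp flip: card_Suc_Diff1[OF finite_V ground_in])
  also have "\<dots> \<le> (\<Sum>i\<in>V - {v}. wdeg a V i * g i i)"
    using pos by (intro sum_mono wdeg_mult_green_diag_ge_1) auto
  also have "\<dots> = green_trace a V g"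
    unfolding green_trace_def using finite_V ground_in by (simp add: sum.remove green_ground)
  finally show ?thesis .
qed

lemma green_mass_ge_half_vol: "vol a V / 2 \<le> green_mass a V g"
proof -
  define y :: "'a \<Rightarrow> real" where "y = (\<lambda>i. - of_bool (i = v))"
  have "energy a V y y = wdeg a V v"
    using finite_V ground_in unfolding sum_laplacian[symmetric] y_def
    by (simp add: sum_negf laplacian_cmult[of a V "-1", simplified] laplacian_of_bool a_irrefl)
  moreover have "(\<Sum>i\<in>V. wdeg a V i * (y i - y v)) = vol a V - wdeg a V v"
    using finite_V ground_in
    by (simp add: y_def vol_def right_diff_distrib distrib_left sum_subtractf sum.distrib)
  ultimately have "2 * (vol a V - wdeg a V v) - wdeg a V v \<le> green_mass a V g"
    using green_form_ge_dual[of "wdeg a V" y] by (simp add: green_mass_def)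
  then show ?thesis
    using wdeg_le_half_vol[OF finite_V ground_in] by (simp add: field_simps)
qed

lemma green_form_ge:
  assumes balanced: "(\<Sum>i\<in>V. b i) = 0" and pos: "\<And>i. i \<in> V \<Longrightarrow> wdeg a V i > 0"
  shows "(\<Sum>i\<in>V. (b i)\<^sup>2 / wdeg a V i) / 2 \<le> green_form V g b b"
proof -
  define y where "y = (\<lambda>i. b i / (2 * wdeg a V i))"
  define s where "s = (\<Sum>i\<in>V. (b i)\<^sup>2 / wdeg a V i)"
  have "(\<Sum>i\<in>V. b i * (y i - y v)) = (\<Sum>i\<in>V. b i * y i)"
    using balanced by (simp add: right_diff_distrib sum_subtractf flip: sum_distrib_right)
  also have "\<dots> = s / 2"
    by (simp add: y_def s_def sum_divide_distrib power2_eq_square mult.commute)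
  finally have linear: "(\<Sum>i\<in>V. b i * (y i - y v)) = s / 2" .
  have "(\<Sum>i\<in>V. wdeg a V i * (y i)\<^sup>2) = s / 4"
    unfolding s_def y_def sum_divide_distrib using pos
    by (intro sum.cong refl) (simp add: power2_eq_square less_imp_neq[symmetric])
  then have "energy a V y y \<le> s / 2"
    using energy_le[of V y] by simp
  then show ?thesis
    using green_form_ge_dual[of b y] by (simp add: linear s_def)
qed

lemma potential_row:
  assumes "i \<in> V" "j \<in> V"
  shows "potential V g (a j) i = wdeg a V j * g j i - of_bool (j = i) + of_bool (j = v)"
proof -
  have "potential V g (a j) i = (\<Sum>n\<in>V. a j n * g n i)"
    unfolding potential_def using assms by (intro sum.cong refl) (simp add: green_sym)
  then show ?thesis
    using laplacian_green[OF assms(2,1)] by (simp add: laplacian_def)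
qed

lemma green_trace_eq: "green_trace a V g = real (card V) - 1 + (\<Sum>j\<in>V. \<Sum>i\<in>V. a j i * g j i)"
proof -
  have "(\<Sum>j\<in>V. \<Sum>i\<in>V. a j i * g j i) = (\<Sum>j\<in>V. potential V g (a j) j)"
    unfolding potential_def by (simp add: mult.commute)
  also have "\<dots> = green_trace a V g - real (card V) + 1"
    using finite_V ground_in
    by (simp add: potential_row green_trace_def sum.distrib sum_subtractf)
  finally show ?thesis by simp
qed

lemma sum_green_form_rows:
  assumes pos: "\<And>i. i \<in> V \<Longrightarrow> wdeg a V i > 0"
  shows "(\<Sum>j\<in>V. green_form V g (a j) (a j) / wdeg a V j) = green_trace a V g - real (card V) + 2"
proof -
  have "green_form V g (a j) (a j) = wdeg a V j * ((\<Sum>i\<in>V. a j i * g j i) + of_bool (j = v))"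
    if "j \<in> V" for j
  proof -
    have "green_form V g (a j) (a j) =
        (\<Sum>i\<in>V. wdeg a V j * (a j i * g j i) - a j i * of_bool (j = i) + of_bool (j = v) * a j i)"
      unfolding green_form_def using that
      by (intro sum.cong refl) (simp add: potential_row algebra_simps)
    then show ?thesis
      using that finite_V
      by (simp add: sum.distrib sum_subtractf a_irrefl distrib_left wdeg_def flip: sum_distrib_left)
  qed
  then have "(\<Sum>j\<in>V. green_form V g (a j) (a j) / wdeg a V j) =
      (\<Sum>j\<in>V. (\<Sum>i\<in>V. a j i * g j i) + of_bool (j = v))"
    using pos by (intro sum.cong refl) (simp add: less_imp_neq[symmetric])
  also have "\<dots> = green_trace a V g - real (card V) + 2"
    using finite_V ground_in by (simp add: sum.distrib green_trace_eq)
  finally show ?thesis .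
qed

lemma sum_green_form_row_degrees: "(\<Sum>j\<in>V. green_form V g (a j) (wdeg a V)) = green_mass a V g"
proof -
  have "(\<Sum>j\<in>V. a j i) = wdeg a V i" for i by (simp add: wdeg_def a_sym)
  then show ?thesis
    unfolding green_form_def green_mass_def by (subst sum.swap) (simp flip: sum_distrib_right)
qed

lemma sum_green_form_centred_rows:
  assumes pos: "\<And>i. i \<in> V \<Longrightarrow> wdeg a V i > 0"
  defines "b \<equiv> \<lambda>j i. a j i - wdeg a V j / vol a V * wdeg a V i"
  shows "(\<Sum>j\<in>V. green_form V g (b j) (b j) / wdeg a V j) =
    green_trace a V g - green_mass a V g / vol a V - (real (card V) - 2)"
proof -
  define W where "W = vol a V"
  have "W > 0" unfolding W_def using vol_pos[OF finite_V ground_in pos] .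
  have "(\<Sum>j\<in>V. green_form V g (b j) (b j) / wdeg a V j) =
      (\<Sum>j\<in>V. green_form V g (a j) (a j) / wdeg a V j - 2 / W * green_form V g (a j) (wdeg a V)
        + wdeg a V j * (green_mass a V g / W\<^sup>2))"
    unfolding b_def green_form_diff_cmult green_mass_def[symmetric] W_def[symmetric]
    using pos \<open>W > 0\<close>
    by (intro sum.cong refl) (simp add: field_simps power2_eq_square less_imp_neq[symmetric])
  also have "\<dots> = green_trace a V g - real (card V) + 2 - 2 / W * green_mass a V g
      + W * (green_mass a V g / W\<^sup>2)"
    by (simp only: sum.distrib sum_subtractf flip: sum_distrib_left sum_distrib_right)
      (simp add: sum_green_form_rows[OF pos] sum_green_form_row_degrees W_def vol_def)
  finally show ?thesis
    using \<open>W > 0\<close> by (simp add: W_def[symmetric] field_simps power2_eq_square)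
qed

lemma return_trace_minus_1:
  assumes pos: "\<And>i. i \<in> V \<Longrightarrow> wdeg a V i > 0"
  defines "b \<equiv> \<lambda>j i. a j i - wdeg a V j / vol a V * wdeg a V i"
  shows "(\<Sum>j\<in>V. (\<Sum>i\<in>V. (b j i)\<^sup>2 / wdeg a V i) / wdeg a V j) = return_trace a V - 1"
proof -
  define W where "W = vol a V"
  define d where "d = wdeg a V"
  have "W > 0" unfolding W_def using vol_pos[OF finite_V ground_in pos] .
  have a_sum: "(\<Sum>j\<in>V. \<Sum>i\<in>V. 2 / W * a j i) = 2 / W * W"
    unfolding sum_distrib_left[symmetric] by (simp add: W_def vol_def wdeg_def)
  have d_sum: "(\<Sum>j\<in>V. \<Sum>i\<in>V. d j * d i / W\<^sup>2) = W * W / W\<^sup>2"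
    by (simp add: W_def vol_def d_def flip: sum_product sum_divide_distrib)
  have "(\<Sum>j\<in>V. (\<Sum>i\<in>V. (b j i)\<^sup>2 / d i) / d j) =
      (\<Sum>j\<in>V. \<Sum>i\<in>V. (a j i)\<^sup>2 / (d j * d i) - 2 / W * a j i + d j * d i / W\<^sup>2)"
    unfolding sum_divide_distrib b_def W_def[symmetric] d_def[symmetric]
    using pos[folded d_def] \<open>W > 0\<close>
    by (intro sum.cong refl) (simp add: field_simps power2_eq_square less_imp_neq[symmetric])
  also have "\<dots> = return_trace a V - 2 / W * W + W * W / W\<^sup>2"
    by (simp only: sum.distrib sum_subtractf a_sum d_sum return_trace_def d_def[symmetric])
  finally show ?thesis
    using \<open>W > 0\<close> by (simp add: d_def power2_eq_square)
qed

lemma green_trace_minus_mass_ge: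
  assumes pos: "\<And>i. i \<in> V \<Longrightarrow> wdeg a V i > 0"
  shows "real (card V) - 2 + (return_trace a V - 1) / 2
    \<le> green_trace a V g - green_mass a V g / vol a V"
proof -
  define b where "b = (\<lambda>j i. a j i - wdeg a V j / vol a V * wdeg a V i)"
  have "vol a V > 0" by (rule vol_pos[OF finite_V ground_in pos])
  then have balanced: "(\<Sum>i\<in>V. b j i) = 0" for j
    unfolding b_def sum_subtractf sum_distrib_left[symmetric] vol_def[symmetric]
    by (simp add: wdeg_def)
  define q where "q = (\<lambda>j. \<Sum>i\<in>V. (b j i)\<^sup>2 / wdeg a V i)"
  have "(return_trace a V - 1) / 2 = (\<Sum>j\<in>V. q j / wdeg a V j) / 2"
    by (simp only: q_def b_def return_trace_minus_1[OF pos])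
  also have "\<dots> = (\<Sum>j\<in>V. q j / 2 / wdeg a V j)"
    by (simp add: sum_divide_distrib mult.commute)
  also have "\<dots> \<le> (\<Sum>j\<in>V. green_form V g (b j) (b j) / wdeg a V j)"
    unfolding q_def using green_form_ge[OF balanced pos] wdeg_nonneg
    by (intro sum_mono divide_right_mono)
  also have "\<dots> = green_trace a V g - green_mass a V g / vol a V - (real (card V) - 2)"
    unfolding b_def by (rule sum_green_form_centred_rows[OF pos])
  finally show ?thesis by linarith
qed

end

lemma green_values_cong:
  assumes "green_function a V v g" "green_function b V v h"
    and ab: "\<And>i j. i \<in> V \<Longrightarrow> j \<in> V \<Longrightarrow> a i j = b i j"
  shows "green_trace a V g = green_trace b V h" "green_mass a V g = green_mass b V h"
proof -
  interpret first: green_function a V v g by fact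
  interpret second: green_function b V v h by fact
  have "green_function b V v g"
  proof unfold_locales
    show "laplacian b V (\<lambda>n. g n j) i = of_bool (i = j)" if "i \<in> V" "i \<noteq> v" "j \<in> V" for i j
      using first.laplacian_green_off_ground[OF that] laplacian_cong[OF ab refl that(1)] by simp
  qed (use first.finite_V first.ground_in first.green_ground in auto)
  then have g: "g i j = h i j" if "i \<in> V" "j \<in> V" for i j using that by (rule second.green_unique)
  have "wdeg a V i = wdeg b V i" if "i \<in> V" for i using that ab by (simp add: wdeg_def)
  then show "green_trace a V g = green_trace b V h" "green_mass a V g = green_mass b V h"
    using g by (simp_all add: green_trace_def green_mass_def green_form_def potential_def)
qed

lemma green_function_exists:
  assumes "network a" and V: "finite V" "v \<in> V"
    and connected: "\<And>x i. x v = (0::real) \<Longrightarrow>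
      (\<And>i j. i \<in> V \<Longrightarrow> j \<in> V \<Longrightarrow> a i j > 0 \<Longrightarrow> x i = x j) \<Longrightarrow> i \<in> V \<Longrightarrow> x i = 0"
  shows "\<exists>g. green_function a V v g"
proof -
  interpret network a by fact
  define M where "M = (\<lambda>i j.
    if i = v then of_bool (i = j) else wdeg a V i * of_bool (i = j) - a i j)"
  have M: "(\<Sum>j\<in>V. M i j * x j) = (if i = v then x v else laplacian a V x i)" if "i \<in> V" for i x
    using V that by (simp add: M_def laplacian_def left_diff_distrib sum_subtractf mult.assoc
        flip: sum_distrib_left)
  have "\<exists>x. \<forall>i\<in>V. (\<Sum>k\<in>V. M i k * x k) = of_bool (i \<noteq> v \<and> i = j)" for j
  proof (rule linear_system_solvable_if_trivial_kernel[OF V(1)])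
    fix x i assume system: "\<And>i. i \<in> V \<Longrightarrow> (\<Sum>j\<in>V. M i j * x j) = 0" and "i \<in> V"
    have "x v = 0" using system[OF V(2)] V by (simp add: M)
    have "energy a V x x = (\<Sum>i\<in>V. 0)"
      unfolding sum_laplacian[symmetric]
      using system M \<open>x v = 0\<close> by (intro sum.cong refl) (metis mult_zero_left mult_zero_right)
    then have "x i = x j" if "i \<in> V" "j \<in> V" "a i j > 0" for i j
      using energy_eq_0_imp_constant_on_edges[OF V(1) _ that] by simp
    with \<open>x v = 0\<close> show "x i = 0" using \<open>i \<in> V\<close> by (rule connected)
  qed
  then obtain X where X: "\<And>i j. i \<in> V \<Longrightarrow> (\<Sum>k\<in>V. M i k * X j k) = of_bool (i \<noteq> v \<and> i = j)"
    by metis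
  have "green_function a V v (\<lambda>i j. X j i)"
  proof unfold_locales
    show "X j v = 0" for j
      using X[OF V(2), of j] V by (simp add: M)
    show "laplacian a V (X j) i = of_bool (i = j)" if "i \<in> V" "i \<noteq> v" for i j
      using X[of i j] M[of i "X j"] that by simp
  qed (use V in auto)
  then show ?thesis by blast
qed

section \<open>Cut vertices\<close>

text \<open>If the network is attached at its ground to a graph with \<open>m\<close> edges, then positivity of the
  slack makes Kemeny's constant larger than if the star were attached instead.\<close>

definition braess_slack :: "real \<Rightarrow> ('a \<Rightarrow> 'a \<Rightarrow> real) \<Rightarrow> 'a set \<Rightarrow> ('a \<Rightarrow> 'a \<Rightarrow> real) \<Rightarrow> real" where
  "braess_slack m a V g =
    (2 * m + vol a V) * (green_trace a V g - (real (card V) - 1)) + vol a V / 2 - green_mass a V g"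

lemma sum_Un_if_zero_on_Int:
  fixes f :: "'a \<Rightarrow> real"
  assumes "finite A" "finite B" "\<And>i. i \<in> A \<inter> B \<Longrightarrow> f i = 0"
  shows "(\<Sum>i\<in>A \<union> B. f i) = (\<Sum>i\<in>A. f i) + (\<Sum>i\<in>B. f i)"
  using sum.union_inter[OF assms(1,2), of f] assms(3) by simp

locale cut_network = network a for a :: "'a \<Rightarrow> 'a \<Rightarrow> real" +
  fixes V1 V2 :: "'a set" and v :: 'a
  assumes finite_V1: "finite V1" and finite_V2: "finite V2" and cut: "V1 \<inter> V2 = {v}"
    and separated: "i \<in> V1 - {v} \<Longrightarrow> j \<in> V2 - {v} \<Longrightarrow> a i j = 0"
begin

lemma cut_network_commute: "cut_network a V2 V1 v"
  using finite_V1 finite_V2 cut separated a_sym by unfold_locales (auto, metis Diff_iff singletonD)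

lemma sum_row_left:
  assumes "i \<in> V1 - {v}"
  shows "(\<Sum>j\<in>V1 \<union> V2. a i j * x j) = (\<Sum>j\<in>V1. a i j * x j)"
  using finite_V1 finite_V2 assms cut by (intro sum.mono_neutral_right) (auto intro!: separated)

lemma wdeg_left: "i \<in> V1 - {v} \<Longrightarrow> wdeg a (V1 \<union> V2) i = wdeg a V1 i"
  using sum_row_left[of i "\<lambda>_. 1"] by (simp add: wdeg_def)

lemma laplacian_left: "i \<in> V1 - {v} \<Longrightarrow> laplacian a (V1 \<union> V2) x i = laplacian a V1 x i"
  by (simp add: laplacian_def wdeg_left sum_row_left)

lemma card_cut: "real (card (V1 \<union> V2)) - 1 = (real (card V1) - 1) + (real (card V2) - 1)"
  using card_Un_Int[OF finite_V1 finite_V2] cut by simp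

lemma vol_cut: "vol a (V1 \<union> V2) = vol a V1 + vol a V2"
proof -
  interpret swapped: cut_network a V2 V1 v by (rule cut_network_commute)
  have "wdeg a (V1 \<union> V2) v = wdeg a V1 v + wdeg a V2 v"
    unfolding wdeg_def using finite_V1 finite_V2 cut
    by (intro sum_Un_if_zero_on_Int) (simp_all add: a_irrefl)
  then have "wdeg a (V1 \<union> V2) i = of_bool (i \<in> V1) * wdeg a V1 i + of_bool (i \<in> V2) * wdeg a V2 i"
    if "i \<in> V1 \<union> V2" for i
    using that cut wdeg_left[of i] swapped.wdeg_left[of i]
    by (cases "i = v") (auto simp: Un_commute)
  then have "vol a (V1 \<union> V2) =
      (\<Sum>i\<in>V1 \<union> V2. of_bool (i \<in> V1) * wdeg a V1 i) + (\<Sum>i\<in>V1 \<union> V2. of_bool (i \<in> V2) * wdeg a V2 i)"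
    unfolding vol_def by (simp only: sum.distrib cong: sum.cong)
  then show ?thesis
    using finite_V1 finite_V2 by (simp add: vol_def Int_absorb1 Int_absorb2)
qed

context
  fixes g assumes g: "green_function a (V1 \<union> V2) v g"
begin

interpretation green_function a "V1 \<union> V2" v g by (rule g)

lemma green_function_left: "green_function a V1 v g"
proof unfold_locales
  show "laplacian a V1 (\<lambda>n. g n j) i = of_bool (i = j)" if "i \<in> V1" "i \<noteq> v" "j \<in> V1" for i j
    using that laplacian_left[of i "\<lambda>n. g n j"] laplacian_green_off_ground[of i j] by simp
qed (use finite_V1 cut green_ground in auto)

lemma green_across_cut:
  assumes i: "i \<in> V1" and j: "j \<in> V2"
  shows "g i j = 0"
proof -
  interpret left: green_function a V1 v g by (rule green_function_left)
  have "g k i * laplacian a V1 (\<lambda>n. g n j) k = 0" if k: "k \<in> V1" for k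
  proof (cases "k = v")
    case False
    then have "laplacian a V1 (\<lambda>n. g n j) k = of_bool (k = j)"
      using k j laplacian_left[of k "\<lambda>n. g n j"] laplacian_green_off_ground[of k j] by simp
    moreover have "k \<noteq> j" using False k j cut by auto
    ultimately show ?thesis by simp
  qed (use i left.green_ground in simp)
  then have "(\<Sum>k\<in>V1. g k i * laplacian a V1 (\<lambda>n. g n j) k) = 0"
    by (intro sum.neutral) blast
  then show ?thesis
    using left.green_representation[OF i, of "\<lambda>n. g n j"] j green_ground[of j] by simp
qed

lemma potential_wdeg_left:
  assumes i: "i \<in> V1"
  shows "potential (V1 \<union> V2) g (wdeg a (V1 \<union> V2)) i = potential V1 g (wdeg a V1) i"
  unfolding potential_def
proof (rule sum.mono_neutral_cong_right)
  show "g i j * wdeg a (V1 \<union> V2) j = g i j * wdeg a V1 j" if "j \<in> V1" for j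
    using that i green_ground_right[of i] wdeg_left[of j] by (cases "j = v") auto
qed (use finite_V1 finite_V2 i green_across_cut in auto)

lemma wdeg_mult_green_left:
  assumes i: "i \<in> V1"
  shows "wdeg a (V1 \<union> V2) i * g i i = wdeg a V1 i * g i i"
  using i green_ground[of v] wdeg_left[of i] ground_in by (cases "i = v") auto

lemma wdeg_mult_potential_left:
  assumes i: "i \<in> V1"
  shows "wdeg a (V1 \<union> V2) i * potential (V1 \<union> V2) g (wdeg a (V1 \<union> V2)) i =
    wdeg a V1 i * potential V1 g (wdeg a V1) i"
  using i potential_ground potential_wdeg_left[OF i] wdeg_left[of i] by (cases "i = v") auto

end

context
  fixes g assumes g: "green_function a (V1 \<union> V2) v g"
begin

interpretation green_function a "V1 \<union> V2" v g by (rule g)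

interpretation swapped: cut_network a V2 V1 v by (rule cut_network_commute)

lemma green_function_right: "green_function a V2 v g"
  using swapped.green_function_left g by (simp add: Un_commute)

lemma green_trace_cut: "green_trace a (V1 \<union> V2) g = green_trace a V1 g + green_trace a V2 g"
proof -
  let ?f = "\<lambda>i. wdeg a (V1 \<union> V2) i * g i i"
  have "green_trace a (V1 \<union> V2) g = (\<Sum>i\<in>V1. ?f i) + (\<Sum>i\<in>V2. ?f i)"
    unfolding green_trace_def using cut green_ground[OF ground_in]
    by (intro sum_Un_if_zero_on_Int[OF finite_V1 finite_V2]) simp
  then show ?thesis
    by (simp add: green_trace_def wdeg_mult_green_left[OF g]
        swapped.wdeg_mult_green_left[unfolded Un_commute[of V2 V1], OF g])
qed

lemma green_mass_cut: "green_mass a (V1 \<union> V2) g = green_mass a V1 g + green_mass a V2 g"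
proof -
  let ?f = "\<lambda>i. wdeg a (V1 \<union> V2) i * potential (V1 \<union> V2) g (wdeg a (V1 \<union> V2)) i"
  have "green_mass a (V1 \<union> V2) g = (\<Sum>i\<in>V1. ?f i) + (\<Sum>i\<in>V2. ?f i)"
    unfolding green_mass_def green_form_def using cut potential_ground
    by (intro sum_Un_if_zero_on_Int[OF finite_V1 finite_V2]) simp
  then show ?thesis
    by (simp add: green_mass_def green_form_def wdeg_mult_potential_left[OF g]
        swapped.wdeg_mult_potential_left[unfolded Un_commute[of V2 V1], OF g])
qed

lemma braess_slack_superadditive:
  assumes "\<And>i. i \<in> V1 \<Longrightarrow> wdeg a V1 i > 0" "\<And>i. i \<in> V2 \<Longrightarrow> wdeg a V2 i > 0"
  shows "braess_slack m a V1 g + braess_slack m a V2 g \<le> braess_slack m a (V1 \<union> V2) g"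
proof -
  let ?excess = "\<lambda>V. green_trace a V g - (real (card V) - 1)"
  have "?excess V1 \<ge> 0" "?excess V2 \<ge> 0"
    using green_function.green_trace_ge[OF green_function_left[OF g]]
      green_function.green_trace_ge[OF green_function_right] assms by simp_all
  then have "0 \<le> vol a V2 * ?excess V1 + vol a V1 * ?excess V2"
    using vol_nonneg by simp
  also have "\<dots> = braess_slack m a (V1 \<union> V2) g - (braess_slack m a V1 g + braess_slack m a V2 g)"
    unfolding braess_slack_def vol_cut card_cut green_trace_cut green_mass_cut
    by (simp add: algebra_simps add_divide_distrib)
  finally show ?thesis by simp
qed

end

end

section \<open>Unit conductances\<close>

locale unit_network = network +
  assumes zero_or_one: "a i j = 0 \<or> a i j = 1"
begin

lemma wdeg_le_card:
  assumes "finite V" "i \<in> V"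
  shows "wdeg a V i \<le> real (card V) - 1"
proof -
  have "wdeg a V i = (\<Sum>j\<in>V - {i}. a i j)"
    unfolding wdeg_def using assms by (simp add: sum.remove a_irrefl)
  also have "\<dots> \<le> (\<Sum>j\<in>V - {i}. 1)"
    using zero_or_one by (intro sum_mono) (metis order_refl zero_le_one)
  finally show ?thesis
    by (simp flip: card_Suc_Diff1[OF assms])
qed

lemma vol_insert_ge:
  assumes "finite T" "i \<in> T" "j \<notin> T" "a i j \<noteq> 0"
  shows "vol a T + 2 \<le> vol a (insert j T)"
proof -
  have "vol a (insert j T) = (\<Sum>n\<in>T. a j n) + (\<Sum>n\<in>T. a n j + wdeg a T n)"
    using assms by (simp add: vol_def wdeg_def a_irrefl)
  also have "\<dots> = 2 * (\<Sum>n\<in>T. a j n) + vol a T"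
    by (simp add: vol_def sum.distrib a_sym)
  finally have "vol a (insert j T) = 2 * (\<Sum>n\<in>T. a j n) + vol a T" .
  moreover have "a j i \<le> (\<Sum>n\<in>T. a j n)"
    using assms a_nonneg by (intro member_le_sum) auto
  ultimately show ?thesis using zero_or_one[of i j] assms a_sym[of i j] by simp
qed

lemma connected_subset_exists:
  assumes "finite P"
    and crossing: "\<forall>T. T \<noteq> {} \<longrightarrow> T \<subset> P \<longrightarrow> (\<exists>i\<in>T. \<exists>j\<in>P - T. a i j \<noteq> 0)"
    and "Suc n \<le> card P"
  shows "\<exists>T\<subseteq>P. card T = Suc n \<and> real n \<le> vol a T / 2"
  using assms(3)
proof (induction n)
  case 0
  then obtain p where "p \<in> P" by fastforce
  then show ?case by (intro exI[of _ "{p}"]) (simp add: vol_def wdeg_def a_irrefl)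
next
  case (Suc n)
  then obtain T where T: "T \<subseteq> P" "card T = Suc n" "real n \<le> vol a T / 2"
    using Suc_leD by blast
  have "T \<noteq> {}" using T(2) by auto
  moreover have "T \<noteq> P" using T(2) Suc.prems by auto
  ultimately obtain i j where ij: "i \<in> T" "j \<in> P - T" "a i j \<noteq> 0"
    using T(1) crossing by blast
  have "finite T" using T(1) assms(1) by (rule finite_subset)
  then have "vol a T + 2 \<le> vol a (insert j T)"
    using vol_insert_ge[of T i j] ij by simp
  then show ?case
    using T ij \<open>finite T\<close> by (intro exI[of _ "insert j T"]) simp
qed

lemma connected_vol_ge:
  assumes "finite P" "P \<noteq> {}"
    and crossing: "\<forall>T. T \<noteq> {} \<longrightarrow> T \<subset> P \<longrightarrow> (\<exists>i\<in>T. \<exists>j\<in>P - T. a i j \<noteq> 0)"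
  shows "real (card P) - 1 \<le> vol a P / 2"
proof -
  have "card P \<ge> 1" using assms(1,2) by (simp add: card_gt_0_iff Suc_le_eq)
  then obtain T where T: "T \<subseteq> P" "card T = Suc (card P - 1)" "real (card P - 1) \<le> vol a T / 2"
    using connected_subset_exists[OF assms(1) crossing, of "card P - 1"] by auto
  have "T = P" using T(1,2) \<open>card P \<ge> 1\<close> by (intro card_subset_eq[OF assms(1)]) simp_all
  then show ?thesis using T(3) \<open>card P \<ge> 1\<close> by (simp add: of_nat_diff)
qed

end

section \<open>Networks with a hub\<close>

lemma sum_squares_divide_ge:
  fixes x y :: "'a \<Rightarrow> real"
  assumes pos: "\<And>i. i \<in> S \<Longrightarrow> y i > 0"
  shows "(\<Sum>i\<in>S. x i)\<^sup>2 / (\<Sum>i\<in>S. y i) \<le> (\<Sum>i\<in>S. (x i)\<^sup>2 / y i)"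
proof (cases "(\<Sum>i\<in>S. y i) > 0")
  case True
  have "(\<Sum>i\<in>S. x i)\<^sup>2 = (\<Sum>i\<in>S. x i / sqrt (y i) * sqrt (y i))\<^sup>2"
    using pos
    by (intro arg_cong[where f = "\<lambda>t. t\<^sup>2"] sum.cong refl) (simp add: less_imp_neq[symmetric])
  also have "\<dots> \<le> (\<Sum>i\<in>S. (x i / sqrt (y i))\<^sup>2) * (\<Sum>i\<in>S. (sqrt (y i))\<^sup>2)"
    by (rule Cauchy_Schwarz_ineq_sum)
  also have "\<dots> = (\<Sum>i\<in>S. (x i)\<^sup>2 / y i) * (\<Sum>i\<in>S. y i)"
    using pos by (simp add: power_divide less_imp_le)
  finally show ?thesis using True by (simp add: pos_divide_le_eq)
next
  case False
  then have "(\<Sum>i\<in>S. y i) = 0"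
    using sum_nonneg[of S y] pos by (simp add: less_imp_le order.antisym)
  then show ?thesis using pos by (simp add: sum_nonneg less_imp_le)
qed

lemma hub_polynomial_less:
  fixes k w M :: real
  assumes k: "k \<ge> 2" and w: "w \<ge> 2 * k - 2"
    and M: "w \<ge> 2 * k \<Longrightarrow> M \<ge> k" "w < 2 * k \<Longrightarrow> M \<ge> k + 1"
  shows "k * (2 * k + w) * (w + k - 1) < 2 * M * (w * (k + w))"
proof (cases "w \<ge> 2 * k")
  case True
  have "k * (2 * k + w) * (w + k - 1) < k * (2 * (w * (k + w)))"
  proof -
    have "2 * (k * w) \<le> w * w" "2 * (k * k) \<le> k * w"
      using mult_right_mono[OF True, of w] mult_left_mono[OF True, of k] True k by simp_all
    moreover have "2 * (w * (k + w)) - (2 * k + w) * (w + k - 1) =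
        w * w - k * w - 2 * (k * k) + 2 * k + w"
      by (simp add: algebra_simps)
    ultimately have "(2 * k + w) * (w + k - 1) < 2 * (w * (k + w))"
      using k True by linarith
    then show ?thesis using k by (simp add: mult.assoc)
  qed
  also have "\<dots> \<le> M * (2 * (w * (k + w)))"
    using M(1) True k by (intro mult_right_mono) auto
  finally show ?thesis by (simp add: algebra_simps)
next
  case False
  define t where "t = w - (2 * k - 2)"
  have t: "t \<ge> 0" and w_eq: "w = 2 * k - 2 + t" using w by (auto simp: t_def)
  have "2 * (k + 1) * (w * (k + w)) - k * (2 * k + w) * (w + k - 1) =
      (k + 2) * t\<^sup>2 + t * (3 * k\<^sup>2 + 7 * k - 8) + 2 * ((k - 1) * (5 * k - 4))"
    unfolding w_eq by (simp add: algebra_simps power2_eq_square)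
  moreover have "t * (3 * k\<^sup>2 + 7 * k - 8) \<ge> 0"
    using k t zero_le_power2[of k] by (intro mult_nonneg_nonneg) linarith+
  moreover have "(k - 1) * (5 * k - 4) > 0" "(k + 2) * t\<^sup>2 \<ge> 0" using k by simp_all
  ultimately have "k * (2 * k + w) * (w + k - 1) < (k + 1) * (2 * (w * (k + w)))"
    by (simp add: algebra_simps)
  also have "\<dots> \<le> M * (2 * (w * (k + w)))"
    using M(2) False k w by (intro mult_right_mono) auto
  finally show ?thesis by (simp add: algebra_simps)
qed

locale grounded_hub = unit_network a + green_function a "insert v P" v g
  for a :: "'a \<Rightarrow> 'a \<Rightarrow> real" and v :: 'a and P :: "'a set" and g +
  assumes v_notin_P: "v \<notin> P" and hub: "p \<in> P \<Longrightarrow> a v p = 1"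
begin

lemma finite_P: "finite P"
  using finite_V by simp

lemma hub_sym: "p \<in> P \<Longrightarrow> a p v = 1"
  using hub a_sym by metis

lemma sum_hub: "(\<Sum>i\<in>insert v P. f i) = f v + (\<Sum>i\<in>P. f i)" for f :: "'a \<Rightarrow> real"
  using finite_P v_notin_P by simp

lemma card_hub: "real (card (insert v P)) - 1 = real (card P)"
  using finite_P v_notin_P by simp

lemma wdeg_hub: "wdeg a (insert v P) v = real (card P)"
  unfolding wdeg_def sum_hub using hub by (simp add: a_irrefl)

lemma wdeg_leaf: "p \<in> P \<Longrightarrow> wdeg a (insert v P) p = 1 + wdeg a P p"
  unfolding wdeg_def sum_hub using hub_sym by simp

lemma vol_hub: "vol a (insert v P) = 2 * real (card P) + vol a P"
  unfolding vol_def sum_hub wdeg_hub by (simp add: wdeg_leaf sum.distrib)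

lemma wdeg_pos:
  assumes "P \<noteq> {}" "i \<in> insert v P"
  shows "wdeg a (insert v P) i > 0"
  using assms finite_P wdeg_nonneg[of P i] by (auto simp: wdeg_hub wdeg_leaf card_gt_0_iff)

lemma leaf_excess_ge:
  assumes p: "p \<in> P" and card: "card P \<ge> 2"
  defines "k \<equiv> real (card P)"
  shows "(wdeg a P p)\<^sup>2 / (k * (1 + wdeg a P p) - 1) \<le> (1 + wdeg a P p) * g p p - 1"
proof -
  define f where "f = wdeg a P p"
  have "f \<ge> 0" by (simp add: f_def wdeg_nonneg)
  have "2 * 1 \<le> k * (1 + f)" using card \<open>f \<ge> 0\<close> by (intro mult_mono) (simp_all add: k_def)
  then have D: "k * (1 + f) - 1 > 0" by simp
  then have "((1 + f) + k - 2) / (k * (1 + f) - 1) \<le> g p p"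
    using green_diag_ge[of p] p v_notin_P
    by (auto simp: wdeg_leaf wdeg_hub hub_sym f_def k_def mult.commute)
  then have "(1 + f) * (((1 + f) + k - 2) / (k * (1 + f) - 1)) \<le> (1 + f) * g p p"
    using \<open>f \<ge> 0\<close> by (intro mult_left_mono) simp_all
  moreover have "(1 + f) * (((1 + f) + k - 2) / (k * (1 + f) - 1)) - 1 = f\<^sup>2 / (k * (1 + f) - 1)"
    using D by (simp add: field_simps power2_eq_square)
  ultimately show ?thesis by (simp add: f_def)
qed

lemma green_trace_hub_ge:
  assumes card: "card P \<ge> 2"
  defines "k \<equiv> real (card P)"
  shows "(vol a P)\<^sup>2 / (k * (vol a P + k - 1)) \<le> green_trace a (insert v P) g - k"
proof -
  have D: "k * (1 + wdeg a P p) - 1 > 0" for p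
    using card wdeg_nonneg[of P p] mult_mono[of 2 k 1 "1 + wdeg a P p"] by (simp add: k_def)
  have "(\<Sum>p\<in>P. k * (1 + wdeg a P p) - 1) = k * (vol a P + k - 1)"
    by (simp add: sum_subtractf sum.distrib vol_def k_def algebra_simps flip: sum_distrib_left)
  then have "(vol a P)\<^sup>2 / (k * (vol a P + k - 1)) \<le>
      (\<Sum>p\<in>P. (wdeg a P p)\<^sup>2 / (k * (1 + wdeg a P p) - 1))"
    using sum_squares_divide_ge[of P "\<lambda>p. k * (1 + wdeg a P p) - 1" "wdeg a P"] D
    by (simp add: vol_def)
  also have "\<dots> \<le> (\<Sum>p\<in>P. (1 + wdeg a P p) * g p p - 1)"
    unfolding k_def using card by (intro sum_mono leaf_excess_ge)
  also have "\<dots> = green_trace a (insert v P) g - k"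
    unfolding green_trace_def sum_hub using green_ground[of v]
    by (simp add: sum_subtractf wdeg_leaf k_def)
  finally show ?thesis .
qed

lemma return_trace_leaf_row_ge:
  assumes p: "p \<in> P"
  defines "d \<equiv> wdeg a (insert v P)"
  shows "1 / real (card P) \<le> (\<Sum>j\<in>insert v P. (a p j)\<^sup>2 / (d p * d j))"
proof -
  define k where "k = real (card P)"
  have d: "1 \<le> d q" "d q \<le> k" if "q \<in> P" for q
    using that wdeg_leaf[of q] wdeg_nonneg[of P q] wdeg_le_card[OF finite_V, of q] card_hub
    by (auto simp: d_def k_def)
  have "k > 0" using p finite_P by (auto simp: k_def card_gt_0_iff)
  have "(\<Sum>j\<in>P. a p j) = d p - 1"
    using wdeg_leaf[OF p] by (simp add: d_def wdeg_def[of a P])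
  then have "1 / k = 1 / (d p * k) + (\<Sum>j\<in>P. a p j) / (d p * k)"
    using d(1)[OF p] \<open>k > 0\<close> by (simp add: field_simps)
  also have "(\<Sum>j\<in>P. a p j) / (d p * k) \<le> (\<Sum>j\<in>P. (a p j)\<^sup>2 / (d p * d j))"
    unfolding sum_divide_distrib
  proof (rule sum_mono)
    fix j assume j: "j \<in> P"
    have "1 / (d p * k) \<le> 1 / (d p * d j)"
      using d[OF p] d[OF j] by (intro divide_left_mono mult_left_mono mult_pos_pos) auto
    then show "a p j / (d p * k) \<le> (a p j)\<^sup>2 / (d p * d j)"
      using zero_or_one[of p j] by auto
  qed
  finally show ?thesis
    unfolding sum_hub using hub_sym[OF p] by (simp add: d_def wdeg_hub k_def)
qed

lemma return_trace_hub_ge: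
  assumes "P \<noteq> {}"
  defines "k \<equiv> real (card P)"
  shows "1 + k / (k + vol a P) \<le> return_trace a (insert v P)"
proof -
  define d where "d = wdeg a (insert v P)"
  have "k > 0" using assms(1) finite_P by (simp add: k_def card_gt_0_iff)
  have "(\<Sum>p\<in>P. d p) = k + vol a P"
    by (simp add: d_def wdeg_leaf sum.distrib vol_def k_def)
  moreover have "(\<Sum>p\<in>P. 1)\<^sup>2 / (\<Sum>p\<in>P. d p) \<le> (\<Sum>p\<in>P. 1\<^sup>2 / d p)"
    using wdeg_pos[OF assms(1)] by (intro sum_squares_divide_ge) (simp add: d_def)
  ultimately have "k\<^sup>2 / (k + vol a P) \<le> (\<Sum>p\<in>P. 1 / d p)" by (simp add: k_def)
  then have "k / (k + vol a P) \<le> (\<Sum>p\<in>P. 1 / d p) / k"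
    using \<open>k > 0\<close> by (simp add: pos_le_divide_eq power2_eq_square)
  also have "\<dots> = (\<Sum>j\<in>insert v P. (a v j)\<^sup>2 / (d v * d j))"
    unfolding sum_hub by (simp add: a_irrefl hub d_def wdeg_hub k_def sum_divide_distrib
        mult.commute)
  moreover have "(\<Sum>p\<in>P. 1 / k) \<le> (\<Sum>p\<in>P. \<Sum>j\<in>insert v P. (a p j)\<^sup>2 / (d p * d j))"
    unfolding d_def k_def by (intro sum_mono return_trace_leaf_row_ge)
  ultimately show ?thesis
    using \<open>k > 0\<close>
    unfolding return_trace_def d_def[symmetric] sum_hub[of "\<lambda>i. \<Sum>j\<in>insert v P. F i j" for F]
    by (simp add: k_def)
qed

lemma braess_slack_hub_ge:
  assumes "P \<noteq> {}"
  defines "k \<equiv> real (card P)" and "w \<equiv> vol a P"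
  shows "2 * m * (green_trace a (insert v P) g - k) - (2 * k + w) * w / (2 * (k + w))
    \<le> braess_slack m a (insert v P) g"
proof -
  define \<tau> where "\<tau> = green_trace a (insert v P) g - k"
  define A where "A = green_mass a (insert v P) g"
  define r where "r = k / (k + w)"
  have "k > 0" using assms(1) finite_P by (simp add: k_def card_gt_0_iff)
  have "w \<ge> 0" by (simp add: w_def vol_nonneg)
  have card: "real (card (insert v P)) = k + 1" using card_hub by (simp add: k_def)
  define x where "x = A / (2 * k + w)"
  have "k - 1 + (return_trace a (insert v P) - 1) / 2 \<le> k + \<tau> - x"
    using green_trace_minus_mass_ge[OF wdeg_pos] assms(1)
    by (simp add: card x_def \<tau>_def A_def k_def[symmetric] w_def[symmetric] vol_hub)
  moreover have "1 + r \<le> return_trace a (insert v P)"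
    using return_trace_hub_ge[OF assms(1)] by (simp add: r_def k_def w_def)
  ultimately have "x \<le> \<tau> + 1 - r / 2" by (simp add: field_simps)
  then have "A \<le> (2 * k + w) * (\<tau> + 1 - r / 2)"
    using \<open>k > 0\<close> \<open>w \<ge> 0\<close> by (simp add: x_def pos_divide_le_eq mult.commute)
  also have "\<dots> = (2 * k + w) * \<tau> + (2 * k + w) / 2 + (2 * k + w) * w / (2 * (k + w))"
    using \<open>k > 0\<close> \<open>w \<ge> 0\<close> by (simp add: r_def field_simps)
  finally have "2 * m * \<tau> - (2 * k + w) * w / (2 * (k + w)) \<le>
      (2 * m + (2 * k + w)) * \<tau> + (2 * k + w) / 2 - A"
    by (simp add: algebra_simps)
  then show ?thesis
    unfolding braess_slack_def card vol_hub by (simp add: \<tau>_def A_def k_def w_def)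
qed

lemma braess_slack_pos_if_connected:
  assumes card: "card P \<ge> 2" and conn: "real (card P) - 1 \<le> vol a P / 2"
    and m: "real (card P) + of_bool (vol a P / 2 < real (card P)) \<le> 2 * m"
  shows "0 < braess_slack m a (insert v P) g"
proof -
  define k where "k = real (card P)"
  define w where "w = vol a P"
  define \<tau> where "\<tau> = green_trace a (insert v P) g - k"
  have k: "k \<ge> 2" using card by (simp add: k_def)
  have w: "w \<ge> 2 * k - 2" using conn by (simp add: k_def w_def)
  then have "w > 0" using k by simp
  have "m > 0" using m k by (simp add: k_def of_bool_def split: if_splits)
  have "k * (2 * k + w) * (w + k - 1) < 2 * (2 * m) * (w * (k + w))"
    using m by (intro hub_polynomial_less[OF k w]) (simp_all add: k_def w_def)
  then have "(2 * k + w) * w / (2 * (k + w)) < 2 * m * (w\<^sup>2 / (k * (w + k - 1)))"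
    using k \<open>w > 0\<close> by (simp add: divide_simps power2_eq_square) (simp add: algebra_simps)
  also have "\<dots> \<le> 2 * m * \<tau>"
    using green_trace_hub_ge[OF card] \<open>m > 0\<close>
    by (intro mult_left_mono) (simp_all add: k_def w_def \<tau>_def)
  finally have "0 < 2 * m * \<tau> - (2 * k + w) * w / (2 * (k + w))" by simp
  also have "\<dots> \<le> braess_slack m a (insert v P) g"
    unfolding k_def w_def \<tau>_def using card by (intro braess_slack_hub_ge) auto
  finally show ?thesis .
qed

lemma star_green_values:
  assumes vol: "vol a P = 0"
  shows "green_trace a (insert v P) g = real (card P)" "green_mass a (insert v P) g = real (card P)"
proof -
  have wdeg_P: "wdeg a P p = 0" if "p \<in> P" for p
    using that vol finite_P wdeg_nonneg by (simp add: vol_def sum_nonneg_eq_0_iff)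
  then have no_edge: "a p q = 0" if "p \<in> P" "q \<in> P" for p q
    using that finite_P a_nonneg by (simp add: wdeg_def sum_nonneg_eq_0_iff)
  have wdeg: "wdeg a (insert v P) p = 1" if "p \<in> P" for p
    using that by (simp add: wdeg_leaf wdeg_P)
  have g: "g p q = of_bool (p = q)" if "p \<in> P" "q \<in> P" for p q
  proof -
    have "p \<noteq> v" using that v_notin_P by auto
    then show ?thesis
      using that laplacian_green_off_ground[of p q] green_ground[of q]
      unfolding laplacian_def sum_hub by (simp add: no_edge wdeg)
  qed
  have potential: "potential (insert v P) g (wdeg a (insert v P)) p = 1" if "p \<in> P" for p
    unfolding potential_def sum_hub
    using that finite_P by (simp add: green_ground_right g wdeg)
  show "green_trace a (insert v P) g = real (card P)"
    unfolding green_trace_def sum_hub by (simp add: green_ground g wdeg)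
  show "green_mass a (insert v P) g = real (card P)"
    unfolding green_mass_def green_form_def sum_hub by (simp add: potential_ground potential wdeg)
qed

lemma braess_slack_star: "vol a P = 0 \<Longrightarrow> braess_slack m a (insert v P) g = 0"
  unfolding braess_slack_def card_hub vol_hub by (simp add: star_green_values)

lemma separated_parts:
  assumes T: "T \<noteq> {}" "T \<subset> P" and separated: "\<forall>i\<in>T. \<forall>j\<in>P - T. a i j = 0"
  shows "grounded_hub a v T g" "grounded_hub a v (P - T) g"
    "vol a P = vol a T + vol a (P - T)"
    "braess_slack m a (insert v T) g + braess_slack m a (insert v (P - T)) g
      \<le> braess_slack m a (insert v P) g"
proof -
  interpret cut_network a "insert v T" "insert v (P - T)" v
    using T separated finite_P by unfold_locales (auto intro: finite_subset)
  have V: "insert v P = insert v T \<union> insert v (P - T)" using T(2) by auto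
  note green = green_function_axioms[unfolded V]
  show part: "grounded_hub a v T g" and rest: "grounded_hub a v (P - T) g"
    using T(2) green_function_left[OF green] green_function_right[OF green] v_notin_P hub
      unit_network_axioms
    by (auto simp: grounded_hub_def grounded_hub_axioms_def)
  interpret part: grounded_hub a v T g by (rule part)
  interpret rest: grounded_hub a v "P - T" g by (rule rest)
  show "vol a P = vol a T + vol a (P - T)"
    using vol_cut card_cut vol_hub card_hub part.vol_hub part.card_hub rest.vol_hub rest.card_hub
    unfolding V by linarith
  show "braess_slack m a (insert v T) g + braess_slack m a (insert v (P - T)) g
      \<le> braess_slack m a (insert v P) g"
    unfolding V using T part.wdeg_pos rest.wdeg_pos
    by (intro braess_slack_superadditive[OF green]) auto
qed

end

lemma braess_slack_hub:
  assumes "grounded_hub a v P g"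
    and m: "\<And>X. X \<subseteq> P \<Longrightarrow> real (card X) - 1 \<le> vol a X / 2 \<Longrightarrow>
      real (card X) + of_bool (vol a X / 2 < real (card X)) \<le> 2 * m"
  shows "0 \<le> braess_slack m a (insert v P) g \<and>
    (0 < vol a P \<longrightarrow> 0 < braess_slack m a (insert v P) g)"
  using assms
proof (induction "card P" arbitrary: P rule: less_induct)
  case less
  interpret grounded_hub a v P g by (rule less.prems)
  consider (no_edges) "vol a P = 0"
    | (connected) "vol a P > 0"
        "\<forall>T. T \<noteq> {} \<longrightarrow> T \<subset> P \<longrightarrow> (\<exists>i\<in>T. \<exists>j\<in>P - T. a i j \<noteq> 0)"
    | (separated) T where "vol a P > 0" "T \<noteq> {}" "T \<subset> P" "\<forall>i\<in>T. \<forall>j\<in>P - T. a i j = 0"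
    using vol_nonneg[of P] by (metis order_le_less)
  then show ?case
  proof cases
    case no_edges
    then show ?thesis by (simp add: braess_slack_star)
  next
    case connected
    have "card P \<noteq> 0" "card P \<noteq> 1"
      using connected(1) finite_P by (auto simp: vol_def wdeg_def a_irrefl card_1_singleton_iff)
    then have "card P \<ge> 2" by simp
    moreover have "real (card P) - 1 \<le> vol a P / 2"
      using \<open>card P \<noteq> 0\<close> by (intro connected_vol_ge[OF finite_P _ connected(2)]) auto
    ultimately show ?thesis
      using braess_slack_pos_if_connected less.prems(2)[of P] by (simp add: less_imp_le)
  next
    case (separated T)
    note parts = separated_parts[OF separated(2-4)]
    have rest: "P - T \<subset> P" using separated(2,3) by blast
    have "0 \<le> braess_slack m a (insert v X) g \<and> (0 < vol a X \<longrightarrow> 0 < braess_slack m a (insert v X) g)"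
      if X: "grounded_hub a v X g" "X \<subset> P" for X
      using less.hyps[OF psubset_card_mono[OF finite_P X(2)] X(1)] less.prems(2) X(2)
      by (meson order_trans psubset_imp_subset)
    from this[OF parts(1) separated(3)] this[OF parts(2) rest] show ?thesis
      using parts(3) parts(4)[of m] separated(1) by auto
  qed
qed

section \<open>Kemeny's constant of a graph\<close>

definition adj :: "'a ugraph \<Rightarrow> 'a \<Rightarrow> 'a \<Rightarrow> real" where
  "adj G i j = of_bool ({i, j} \<in> edges G)"

lemma simple_graphD:
  assumes "simple_graph G"
  shows "finite (verts G)" "e \<in> edges G \<Longrightarrow> e \<subseteq> verts G" "e \<in> edges G \<Longrightarrow> card e = 2"
  using assms by (auto simp: simple_graph_def)

lemma finite_edges:
  assumes "simple_graph G"
  shows "finite (edges G)"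
proof (rule finite_subset)
  show "edges G \<subseteq> Pow (verts G)" using simple_graphD(2)[OF assms] by blast
qed (simp add: simple_graphD(1)[OF assms])

lemma unit_network_adj:
  assumes "simple_graph G"
  shows "unit_network (adj G)"
proof unfold_locales
  show "adj G i i = 0" for i
    using simple_graphD(3)[OF assms, of "{i}"] by (auto simp: adj_def)
qed (auto simp: adj_def insert_commute)

lemma sum_nbrs_eq:
  assumes "finite (verts G)"
  shows "(\<Sum>k\<in>nbrs G i. f k) = (\<Sum>k\<in>verts G. adj G i k * f k)"
  using assms by (simp add: nbrs_def adj_def Collect_conj_eq Int_commute)

lemma wdeg_adj_eq_card_edges:
  assumes G: "simple_graph G" and S: "finite S" "i \<in> S"
  shows "wdeg (adj G) S i = real (card {e \<in> {e \<in> edges G. e \<subseteq> S}. i \<in> e})"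
proof -
  have "bij_betw (\<lambda>j. {i, j}) {j \<in> S. {i, j} \<in> edges G} {e \<in> {e \<in> edges G. e \<subseteq> S}. i \<in> e}"
  proof (intro bij_betw_imageI)
    show "inj_on (\<lambda>j. {i, j}) {j \<in> S. {i, j} \<in> edges G}"
      by (auto simp: inj_on_def doubleton_eq_iff)
    have "\<exists>j. e = {i, j}" if "e \<in> edges G" "i \<in> e" for e
      using simple_graphD(3)[OF G that(1)] that(2) by (auto simp: card_2_iff)
    then show "(\<lambda>j. {i, j}) ` {j \<in> S. {i, j} \<in> edges G} = {e \<in> {e \<in> edges G. e \<subseteq> S}. i \<in> e}"
      using S(2) by fastforce
  qed
  then show ?thesis
    using S(1) by (simp add: bij_betw_same_card[symmetric] wdeg_def adj_def Collect_conj_eq)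
qed

lemma vol_adj:
  assumes G: "simple_graph G" and S: "finite S"
  shows "vol (adj G) S = 2 * real (card {e \<in> edges G. e \<subseteq> S})"
proof -
  define F where "F = {e \<in> edges G. e \<subseteq> S}"
  have "finite F" using S by (auto simp: F_def intro: finite_subset[of _ "Pow S"])
  have "card {i \<in> S. i \<in> e} = 2" if "e \<in> F" for e
  proof -
    have "{i \<in> S. i \<in> e} = e" "card e = 2" using that G by (auto simp: F_def simple_graph_def)
    then show ?thesis by simp
  qed
  then have "(\<Sum>i\<in>S. card {e \<in> F. i \<in> e}) = 2 * card F"
    using S \<open>finite F\<close> by (intro sum_multicount) auto
  moreover have "vol (adj G) S = real (\<Sum>i\<in>S. card {e \<in> F. i \<in> e})"
    unfolding vol_def F_def using wdeg_adj_eq_card_edges[OF G S] by simp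
  ultimately show ?thesis by (simp add: F_def)
qed

lemma vol_verts:
  assumes "simple_graph G"
  shows "vol (adj G) (verts G) = 2 * real (card (edges G))"
proof -
  have "{e \<in> edges G. e \<subseteq> verts G} = edges G" using simple_graphD(2)[OF assms] by blast
  then show ?thesis using vol_adj[OF assms simple_graphD(1)[OF assms]] by simp
qed

locale grounded_graph = green_function "adj G" "verts G" v g for G :: "'a ugraph" and v g +
  assumes simple: "simple_graph G" and nbrs_nonempty: "i \<in> verts G \<Longrightarrow> nbrs G i \<noteq> {}"
begin

sublocale simple_random_walk G
  using finite_V nbrs_nonempty by unfold_locales

lemma wdeg_eq_deg: "wdeg (adj G) (verts G) i = real (deg G i)"
  using sum_nbrs_eq[OF finite_V, of "\<lambda>_. 1" i] by (simp add: wdeg_def deg_def)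

lemma avg_eq_laplacian:
  "i \<in> verts G \<Longrightarrow> avg f i = f i - laplacian (adj G) (verts G) f i / real (deg G i)"
  using deg_pos[of i]
  by (simp add: avg_def laplacian_def sum_nbrs_eq[OF finite_V] wdeg_eq_deg field_simps)

lemma hitting_time_green:
  defines "W \<equiv> vol (adj G) (verts G)"
    and "x \<equiv> potential (verts G) g (wdeg (adj G) (verts G))"
  assumes i: "i \<in> verts G" and j: "j \<in> verts G"
  shows "hitting_time G i j = W * (g j j - g i j) + x i - x j"
proof (rule hitting_time_eqI[of j "\<lambda>i. W * (g j j - g i j) + x i - x j", OF j _ _ i])
  fix n assume n: "n \<in> verts G" "n \<noteq> j"
  have "laplacian (adj G) (verts G) (\<lambda>i. W * (g j j - g i j) + x i - x j) n =
      W * (of_bool (n = v) - of_bool (n = j)) + (wdeg (adj G) (verts G) n - of_bool (n = v) * W)"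
    unfolding laplacian_diff laplacian_add laplacian_cmult laplacian_const
    by (simp add: laplacian_green[OF n(1) j] laplacian_potential[OF n(1)] x_def W_def vol_def)
  also have "\<dots> = real (deg G n)" using n(2) by (simp add: wdeg_eq_deg)
  finally show "W * (g j j - g n j) + x n - x j = 1 + avg (\<lambda>i. W * (g j j - g i j) + x i - x j) n"
    using deg_pos[OF n(1)] by (simp add: avg_eq_laplacian[OF n(1)])
qed simp

lemma stationary_average_hitting_time:
  assumes i: "i \<in> verts G"
  shows "(\<Sum>j\<in>verts G. stationary G j * hitting_time G i j) =
    green_trace (adj G) (verts G) g - green_mass (adj G) (verts G) g / vol (adj G) (verts G)"
proof -
  define W where "W = vol (adj G) (verts G)"
  define d where "d = wdeg (adj G) (verts G)"
  define x where "x = potential (verts G) g d"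
  have "W > 0"
    unfolding W_def using deg_pos by (intro vol_pos[OF finite_V ground_in]) (simp add: wdeg_eq_deg)
  have "(\<Sum>j\<in>verts G. stationary G j * hitting_time G i j) =
      (\<Sum>j\<in>verts G. d j * g j j - g i j * d j + d j * (x i / W) - d j * x j / W)"
    using \<open>W > 0\<close> vol_verts[OF simple]
    by (intro sum.cong refl)
      (simp add: stationary_def hitting_time_green[OF i] wdeg_eq_deg W_def d_def x_def field_simps)
  also have "\<dots> = green_trace (adj G) (verts G) g - x i + W * (x i / W)
      - green_mass (adj G) (verts G) g / W"
    by (simp add: sum.distrib sum_subtractf green_trace_def green_mass_def green_form_def
        W_def vol_def x_def potential_def d_def flip: sum_distrib_right sum_divide_distrib)
  finally show ?thesis using \<open>W > 0\<close> by (simp add: W_def)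
qed

lemma kemeny_eq_green:
  "kemeny G =
    green_trace (adj G) (verts G) g - green_mass (adj G) (verts G) g / vol (adj G) (verts G)"
  unfolding kemeny_def
  by (rule the_equality) (use stationary_average_hitting_time ground_in in auto)

end

section \<open>Connected graphs\<close>

lemma connected_nbrs_nonempty:
  assumes G: "simple_graph G" "connected_graph G" and "edges G \<noteq> {}" and i: "i \<in> verts G"
  shows "nbrs G i \<noteq> {}"
proof -
  obtain e where "e \<in> edges G" using assms by blast
  then have "e \<subseteq> verts G" "card e = 2" using simple_graphD[OF G(1)] by blast+
  then obtain w where "w \<in> verts G" "w \<noteq> i" unfolding card_2_iff by auto
  then have "(i, w) \<in> {(x, y). {x, y} \<in> edges G}\<^sup>*" using G(2) i by (auto simp: connected_graph_def)
  then obtain y where "{i, y} \<in> edges G" using \<open>w \<noteq> i\<close> by (auto elim: converse_rtranclE)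
  then have "y \<in> nbrs G i" using G(1) by (auto simp: nbrs_def simple_graph_def)
  then show ?thesis by blast
qed

lemma green_function_exists_connected:
  assumes G: "simple_graph G" "connected_graph G" and v: "v \<in> verts G"
  shows "\<exists>g. green_function (adj G) (verts G) v g"
proof (rule green_function_exists[OF _ _ v])
  show "network (adj G)"
    using unit_network_adj[OF G(1)] by (simp add: unit_network_def)
  show "finite (verts G)" by (rule simple_graphD[OF G(1)])
next
  fix x :: "'a \<Rightarrow> real" and i
  assume x: "x v = 0" "\<And>i j. i \<in> verts G \<Longrightarrow> j \<in> verts G \<Longrightarrow> adj G i j > 0 \<Longrightarrow> x i = x j"
    and i: "i \<in> verts G"
  have "(v, i) \<in> {(x, y). {x, y} \<in> edges G}\<^sup>*" using G(2) v i by (auto simp: connected_graph_def)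
  then show "x i = 0"
  proof induction
    case (step y z)
    then have "y \<in> verts G" "z \<in> verts G" "adj G y z > 0"
      using G(1) by (auto simp: simple_graph_def adj_def)
    then show ?case using x(2)[of y z] step.IH by simp
  qed (rule x)
qed

lemma connected_graphI:
  assumes v: "v \<in> verts G"
    and reach: "\<And>u. u \<in> verts G \<Longrightarrow> (u, v) \<in> {(x, y). {x, y} \<in> edges G}\<^sup>*"
  shows "connected_graph G"
  unfolding connected_graph_def
proof (intro conjI ballI)
  let ?R = "{(x, y). {x, y} \<in> edges G}"
  fix u w assume "u \<in> verts G" "w \<in> verts G"
  have "sym (?R\<^sup>*)"
    by (intro sym_rtrancl) (simp add: sym_def insert_commute)
  then have "(v, w) \<in> ?R\<^sup>*" using reach[OF \<open>w \<in> verts G\<close>] by (rule symD)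
  with reach[OF \<open>u \<in> verts G\<close>] show "(u, w) \<in> ?R\<^sup>*" by (rule rtrancl_trans)
qed (use v in blast)

lemma connected_graph_union:
  assumes "connected_graph G" "connected_graph H" and v: "v \<in> verts G" "v \<in> verts H"
  shows "connected_graph (graph_union G H)"
proof (rule connected_graphI)
  let ?R = "\<lambda>G. {(x, y). {x, y} \<in> edges G}"
  show "v \<in> verts (graph_union G H)" using v by (simp add: graph_union_def)
  have mono: "(?R G)\<^sup>* \<subseteq> (?R (graph_union G H))\<^sup>*" "(?R H)\<^sup>* \<subseteq> (?R (graph_union G H))\<^sup>*"
    by (intro rtrancl_mono; auto simp: graph_union_def)+
  fix u assume "u \<in> verts (graph_union G H)"
  then consider "u \<in> verts G" | "u \<in> verts H" by (auto simp: graph_union_def)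
  then have "(u, v) \<in> (?R G)\<^sup>* \<or> (u, v) \<in> (?R H)\<^sup>*"
    using assms unfolding connected_graph_def by cases blast+
  then show "(u, v) \<in> (?R (graph_union G H))\<^sup>*" using mono by blast
qed

section \<open>Graphs with a cut vertex\<close>

lemma graph_union_commute: "graph_union G H = graph_union H G"
  by (simp add: graph_union_def Un_commute)

lemma simple_graph_union: "simple_graph G \<Longrightarrow> simple_graph H \<Longrightarrow> simple_graph (graph_union G H)"
  by (auto simp: simple_graph_def graph_union_def)

lemma adj_graph_union_left:
  assumes H: "simple_graph H" and cut: "verts G \<inter> verts H = {v}"
    and ij: "i \<in> verts G" "j \<in> verts G"
  shows "adj (graph_union G H) i j = adj G i j"
proof -
  have "{i, j} \<notin> edges H"
  proof
    assume "{i, j} \<in> edges H"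
    then have "{i, j} \<subseteq> verts G \<inter> verts H" "card {i, j} = 2"
      using simple_graphD[OF H] ij by auto
    then show False using card_mono[of "{v}" "{i, j}"] cut by simp
  qed
  then show ?thesis by (simp add: adj_def graph_union_def)
qed

lemma cut_network_graph_union:
  assumes "simple_graph G" "simple_graph H" and cut: "verts G \<inter> verts H = {v}"
  shows "cut_network (adj (graph_union G H)) (verts G) (verts H) v"
proof -
  interpret unit_network "adj (graph_union G H)"
    using assms by (intro unit_network_adj simple_graph_union)
  have "{i, j} \<notin> edges G \<union> edges H" if "i \<in> verts G - {v}" "j \<in> verts H - {v}" for i j
    using that cut simple_graphD(2)[OF assms(1), of "{i, j}"]
      simple_graphD(2)[OF assms(2), of "{i, j}"]
    by auto
  then show ?thesis
    using assms by unfold_locales (auto simp: simple_graph_def adj_def graph_union_def)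
qed

lemma kemeny_graph_union:
  assumes G: "simple_graph G" "connected_graph G" and H: "simple_graph H" "connected_graph H"
    and cut: "verts G \<inter> verts H = {v}" and edges: "edges G \<noteq> {}"
    and g: "green_function (adj G) (verts G) v g" and h: "green_function (adj H) (verts H) v h"
  shows "kemeny (graph_union G H) =
    green_trace (adj G) (verts G) g + green_trace (adj H) (verts H) h -
    (green_mass (adj G) (verts G) g + green_mass (adj H) (verts H) h) /
      (vol (adj G) (verts G) + vol (adj H) (verts H))"
proof -
  define U where "U = graph_union G H"
  have verts: "verts U = verts G \<union> verts H" by (simp add: U_def graph_union_def)
  have v: "v \<in> verts G" "v \<in> verts H" using cut by auto
  have U: "simple_graph U" "connected_graph U" "edges U \<noteq> {}"
    using simple_graph_union[OF G(1) H(1)] connected_graph_union[OF G(2) H(2) v] edges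
    by (simp_all add: U_def graph_union_def)
  obtain f where f: "green_function (adj U) (verts U) v f"
    using green_function_exists_connected[OF U(1,2)] v(1) verts by auto
  interpret grounded_graph U v f
    using f U by (intro grounded_graph.intro grounded_graph_axioms.intro connected_nbrs_nonempty)
  interpret cut_network "adj U" "verts G" "verts H" v
    unfolding U_def by (rule cut_network_graph_union[OF G(1) H(1) cut])
  note f = f[unfolded verts]
  have adj_G: "adj U i j = adj G i j" if "i \<in> verts G" "j \<in> verts G" for i j
    unfolding U_def using adj_graph_union_left[OF H(1) cut that] .
  have adj_H: "adj U i j = adj H i j" if "i \<in> verts H" "j \<in> verts H" for i j
    unfolding U_def graph_union_commute[of G]
    using adj_graph_union_left[of G H v, OF G(1) _ that] cut by (simp add: Int_commute)
  have vol: "vol (adj U) (verts G) = vol (adj G) (verts G)"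
      "vol (adj U) (verts H) = vol (adj H) (verts H)"
    by (simp_all add: vol_def wdeg_def adj_G adj_H)
  show ?thesis
    using kemeny_eq_green
    unfolding U_def[symmetric] verts green_trace_cut[OF f] green_mass_cut[OF f] vol_cut
    by (simp add: vol green_values_cong[OF green_function_left[OF f] g adj_G]
        green_values_cong[OF green_function_right[OF f] h adj_H])
qed

section \<open>Stars with additional edges\<close>

locale augmented_star =
  fixes v :: 'a and P :: "'a set" and L :: "'a set set"
  assumes finite_leaves: "finite P" and v_notin_leaves: "v \<notin> P"
    and new_edges: "L \<subseteq> non_edges (star_graph v P)"
begin

definition augmentation :: "'a ugraph" where
  "augmentation = add_edges (star_graph v P) L"

lemma verts_augmentation: "verts augmentation = insert v P"
  by (simp add: augmentation_def add_edges_def star_graph_def)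

lemma edges_augmentation: "edges augmentation = (\<lambda>p. {v, p}) ` P \<union> L"
  by (simp add: augmentation_def add_edges_def star_graph_def)

lemma new_edge_between_leaves:
  assumes "e \<in> L"
  shows "e \<subseteq> P" "card e = 2"
proof -
  have e: "e \<subseteq> insert v P" "card e = 2" "e \<notin> (\<lambda>p. {v, p}) ` P"
    using assms new_edges by (auto simp: non_edges_def star_graph_def)
  have "v \<notin> e"
  proof
    assume "v \<in> e"
    then obtain p where "e = {v, p}" "p \<noteq> v" using e(2) by (auto simp: card_2_iff)
    then show False using e by auto
  qed
  then show "e \<subseteq> P" "card e = 2" using e by auto
qed

lemma simple_augmentation: "simple_graph augmentation"
  using finite_leaves v_notin_leaves new_edge_between_leaves
  by (auto simp: simple_graph_def verts_augmentation edges_augmentation card_2_iff)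

lemma connected_augmentation: "connected_graph augmentation"
proof (rule connected_graphI)
  fix u assume "u \<in> verts augmentation"
  then have "u = v \<or> {u, v} \<in> edges augmentation"
    by (auto simp: verts_augmentation edges_augmentation)
  then show "(u, v) \<in> {(x, y). {x, y} \<in> edges augmentation}\<^sup>*" by auto
qed (simp add: verts_augmentation)

lemma edges_within_leaves: "{e \<in> edges augmentation. e \<subseteq> P} = L"
  using v_notin_leaves new_edge_between_leaves by (auto simp: edges_augmentation)

lemma vol_leaves: "vol (adj augmentation) P = 2 * real (card L)"
  using vol_adj[OF simple_augmentation finite_leaves] by (simp add: edges_within_leaves)

lemma grounded_hub_augmentation:
  assumes "green_function (adj augmentation) (insert v P) v g"
  shows "grounded_hub (adj augmentation) v P g"
  using assms unit_network_adj[OF simple_augmentation] v_notin_leaves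
  by (simp add: grounded_hub_def grounded_hub_axioms_def adj_def edges_augmentation)

lemma green_function_augmentation_exists:
  "\<exists>g. green_function (adj augmentation) (insert v P) v g"
  using green_function_exists_connected[OF simple_augmentation connected_augmentation, of v]
  by (simp add: verts_augmentation)

end

lemma kemeny_gap_arith:
  fixes m n A A' k \<tau> :: real
  assumes "m > 0" "k > 0" "n \<ge> k" "A \<ge> m" and slack: "0 < (2 * m + 2 * n) * \<tau> + n - A'"
  shows "k - (A + k) / (2 * m + 2 * k) < \<tau> + k - (A + A') / (2 * m + 2 * n)"
proof -
  have "A + A' < \<tau> * (2 * m + 2 * n) + (A + n)" using slack by (simp add: mult.commute)
  then have "(A + A') / (2 * m + 2 * n) < \<tau> + (A + n) / (2 * m + 2 * n)"
    using assms(1-3) by (simp add: pos_divide_less_eq distrib_right[of \<tau>])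
  also have "(A + n) / (2 * m + 2 * n) \<le> (A + k) / (2 * m + 2 * k)"
  proof -
    have "0 \<le> (n - k) * (A - m)" using assms by simp
    then have "(A + n) * (2 * m + 2 * k) \<le> (A + k) * (2 * m + 2 * n)" by (simp add: algebra_simps)
    then show ?thesis using assms by (simp add: divide_simps)
  qed
  finally show ?thesis by simp
qed

lemma (in augmented_star) kemeny_graph_union_augmentation:
  assumes G: "simple_graph G" "connected_graph G" "edges G \<noteq> {}"
    and cut: "v \<in> verts G" "P \<inter> verts G = {}"
    and f: "green_function (adj G) (verts G) v f"
    and g: "green_function (adj augmentation) (insert v P) v g"
  shows "kemeny (graph_union G augmentation) =
    green_trace (adj G) (verts G) f + green_trace (adj augmentation) (insert v P) g -
    (green_mass (adj G) (verts G) f + green_mass (adj augmentation) (insert v P) g) /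
      (2 * real (card (edges G)) + 2 * (real (card P) + real (card L)))"
proof -
  interpret grounded_hub "adj augmentation" v P g by (rule grounded_hub_augmentation[OF g])
  have "verts G \<inter> insert v P = {v}" using cut by auto
  then show ?thesis
    using kemeny_graph_union[OF G(1,2) simple_augmentation connected_augmentation _ G(3) f, of g]
    by (simp add: verts_augmentation g vol_hub vol_leaves vol_verts[OF G(1)])
qed

lemma (in augmented_star) kemeny_augmentation_less:
  assumes G: "simple_graph G" "connected_graph G" "edges G \<noteq> {}"
    and cut: "v \<in> verts G" "P \<inter> verts G = {}" and "P \<noteq> {}"
    and slack: "\<And>g. grounded_hub (adj augmentation) v P g \<Longrightarrow>
      0 < braess_slack (real (card (edges G))) (adj augmentation) (insert v P) g"
  shows "kemeny (graph_union G (star_graph v P)) < kemeny (graph_union G augmentation)"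
proof -
  interpret star: augmented_star v P "{}"
    using finite_leaves v_notin_leaves by unfold_locales auto
  have star: "star.augmentation = star_graph v P"
    by (simp add: star.augmentation_def add_edges_def)
  obtain f where f: "green_function (adj G) (verts G) v f"
    using green_function_exists_connected[OF G(1,2) cut(1)] by blast
  obtain g where g: "green_function (adj augmentation) (insert v P) v g"
    using green_function_augmentation_exists by blast
  obtain h where h: "green_function (adj star.augmentation) (insert v P) v h"
    using star.green_function_augmentation_exists by blast
  interpret f: green_function "adj G" "verts G" v f by (rule f)
  interpret g: grounded_hub "adj augmentation" v P g by (rule grounded_hub_augmentation[OF g])
  interpret h: grounded_hub "adj star.augmentation" v P h
    by (rule star.grounded_hub_augmentation[OF h])
  define k where "k = real (card P)"
  define m where "m = real (card (edges G))"
  define A where "A = green_mass (adj G) (verts G) f"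
  define A' where "A' = green_mass (adj augmentation) (insert v P) g"
  define \<tau> where "\<tau> = green_trace (adj augmentation) (insert v P) g - k"
  have "k > 0" using \<open>P \<noteq> {}\<close> finite_leaves by (simp add: k_def card_gt_0_iff)
  have "m > 0" using G(3) finite_edges[OF G(1)] by (simp add: m_def card_gt_0_iff)
  have "m \<le> A" using f.green_mass_ge_half_vol vol_verts[OF G(1)] by (simp add: m_def A_def)
  moreover have "0 < (2 * m + 2 * (k + card L)) * \<tau> + (k + card L) - A'"
    using slack[OF g.grounded_hub_axioms] unfolding braess_slack_def g.card_hub g.vol_hub vol_leaves
    by (simp add: k_def m_def \<tau>_def A'_def distrib_left add_divide_distrib)
  ultimately have
    "k - (A + k) / (2 * m + 2 * k) < \<tau> + k - (A + A') / (2 * m + 2 * (k + card L))"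
    using \<open>m > 0\<close> \<open>k > 0\<close> by (intro kemeny_gap_arith) simp_all
  then show ?thesis
    using kemeny_graph_union_augmentation[OF G cut f g]
      star.kemeny_graph_union_augmentation[OF G cut f h] star.vol_leaves
    by (simp add: star[symmetric] h.star_green_values k_def m_def A_def A'_def \<tau>_def)
qed

lemma twice_edges_ge_if_above_threshold:
  fixes k l m :: nat
  assumes "k \<ge> 2" "l \<ge> 1"
    and m: "real m > (if l < k
            then (sqrt (33 * real l ^ 2 + 50 * real l + 17) - real l - 1) / 8
            else (sqrt (33 * real k ^ 2 - 30 * real k + 1) - real k - 1) / 8)"
  shows "l < k \<Longrightarrow> l + 2 \<le> 2 * m" "k \<le> l \<Longrightarrow> k \<le> 2 * m"
proof -
  assume "l < k"
  have "(5 * (real l + 1))\<^sup>2 \<le> 33 * real l ^ 2 + 50 * real l + 17"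
    using assms(2) one_le_power[of "real l" 2] by (simp add: power2_eq_square algebra_simps)
  then have "5 * (real l + 1) \<le> sqrt (33 * real l ^ 2 + 50 * real l + 17)"
    by (rule real_le_rsqrt)
  then show "l + 2 \<le> 2 * m" using m \<open>l < k\<close> by simp
next
  assume "k \<le> l"
  have "(5 * real k - 3)\<^sup>2 \<le> 33 * real k ^ 2 - 30 * real k + 1"
    using assms(1) one_le_power[of "real k" 2] by (simp add: power2_eq_square algebra_simps)
  then have "5 * real k - 3 \<le> sqrt (33 * real k ^ 2 - 30 * real k + 1)"
    by (rule real_le_rsqrt)
  also have "\<dots> < 8 * real m + real k + 1"
    using m \<open>k \<le> l\<close> by simp
  finally show "k \<le> 2 * m" by simp
qed

lemma (in augmented_star) braess_slack_augmentation_pos: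
  fixes m :: nat
  assumes "L \<noteq> {}"
    and few: "card L < card P \<Longrightarrow> card L + 2 \<le> 2 * m"
    and many: "card P \<le> card L \<Longrightarrow> card P \<le> 2 * m"
    and grounded: "grounded_hub (adj augmentation) v P g"
  shows "0 < braess_slack (real m) (adj augmentation) (insert v P) g"
proof -
  interpret grounded_hub "adj augmentation" v P g by (rule grounded)
  have "finite L"
    using finite_leaves new_edge_between_leaves by (auto intro: finite_subset[of _ "Pow P"])
  have "real (card X) + of_bool (vol (adj augmentation) X / 2 < real (card X)) \<le> 2 * real m"
    if X: "X \<subseteq> P" "real (card X) - 1 \<le> vol (adj augmentation) X / 2" for X
  proof (cases "card L < card P")
    case True
    have "vol (adj augmentation) X \<le> 2 * real (card L)"
      using vol_mono[OF finite_leaves X(1)] vol_leaves by simp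
    then show ?thesis using X(2) few[OF True] by (simp add: of_bool_def)
  next
    case False
    then consider (all) "X = P" | (proper) "card X < card P"
      using X(1) finite_leaves psubset_card_mono by blast
    then show ?thesis
    proof cases
      case all
      then show ?thesis using False many vol_leaves by simp
    next
      case proper
      then show ?thesis using False many by (simp add: of_bool_def)
    qed
  qed
  then show ?thesis
    using braess_slack_hub[OF grounded, of m] vol_leaves \<open>L \<noteq> {}\<close> \<open>finite L\<close>
    by (simp add: card_gt_0_iff)
qed

lemma (in augmented_star) new_edges_subset_non_edges:
  assumes "simple_graph G" "P \<inter> verts G = {}"
  shows "L \<subseteq> non_edges (graph_union G (star_graph v P))"
proof
  fix e assume e: "e \<in> L"
  have "e \<noteq> {}" using new_edge_between_leaves(2)[OF e] by auto
  then have "e \<notin> edges G"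
    using new_edge_between_leaves(1)[OF e] simple_graphD(2)[OF assms(1), of e] assms(2) by blast
  then show "e \<in> non_edges (graph_union G (star_graph v P))"
    using e new_edges by (auto simp: non_edges_def graph_union_def)
qed

theorem theorem4p7:
  fixes G1 G :: "'a ugraph" and v :: 'a and P :: "'a set" and L :: "'a set set"
    and k l :: nat
  assumes "simple_graph G1" and "connected_graph G1" and "v \<in> verts G1"
    and "finite P" and "card P = k" and "P \<inter> verts G1 = {}" and "k \<ge> 2"
    and "G = graph_union G1 (star_graph v P)"
    and "L \<subseteq> non_edges (star_graph v P)" and "card L = l" and "l \<ge> 1"
    and "real (card (edges G1)) >
           (if l < k
            then (sqrt (33 * real l ^ 2 + 50 * real l + 17) - real l - 1) / 8
            else (sqrt (33 * real k ^ 2 - 30 * real k + 1) - real k - 1) / 8)"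
  shows "braess_set G L"
proof -
  interpret augmented_star v P L
    using assms(3,4,6,9) by unfold_locales auto
  note m = twice_edges_ge_if_above_threshold[OF assms(7,11,12)]
  have "edges G1 \<noteq> {}" "L \<noteq> {}" "P \<noteq> {}"
    using m assms(5,7,10,11) by (cases "l < k"; auto)+
  moreover have "0 < braess_slack (card (edges G1)) (adj augmentation) (insert v P) g"
    if "grounded_hub (adj augmentation) v P g" for g
    using m that \<open>L \<noteq> {}\<close> unfolding assms(5,10)[symmetric] by (intro braess_slack_augmentation_pos)
  ultimately have "kemeny G < kemeny (graph_union G1 augmentation)"
    unfolding assms(8) using assms(1-3,6) by (intro kemeny_augmentation_less)
  moreover have "graph_union G1 augmentation = add_edges G L"
    by (simp add: assms(8) graph_union_def augmentation_def add_edges_def Un_assoc)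
  ultimately show ?thesis
    using new_edges_subset_non_edges[OF assms(1,6)] by (simp add: braess_set_def assms(8))
qed

end
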